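(* Let $k$ be an algebraically closed field. The representations $P_r$, $I_r$ ($r\ge 0$), and $R_{p,\lambda}$ ($p\ge 1$ and $\lambda\in\mathbb P^1(k)$) form, up to isomorphism, a complete list of the finite dimensional indecomposable representations over $k$ of the Kronecker quiver; that is, each of them is indecomposable and each finite dimensional indecomposable representation is isomorphic to one of them.
   Context: The Kronecker quiver has two vertices $1,2$ and two arrows $\alpha_1,\alpha_2\colon 1\to 2$. A representation $X$ over $k$ is a pair of linear maps $X_{\alpha_1},X_{\alpha_2}\colon X_1\to X_2$ between two $k$-vector spaces; a morphism $X\to Y$ is a pair of linear maps $\phi_i\colon X_i\to Y_i$ with $Y_{\alpha_j}\phi_1=\phi_2X_{\alpha_j}$ for $j=1,2$. It is indecomposable if it is non-zero and not the direct sum of two non-zero representations. For $r\ge0$: - $P_r$ has spaces $k^r, k^{r+1}$ and maps $X_{\alpha_1}=\begin{bmatrix}\mathrm{id}\\0\end{bmatrix}$, $X_{\alpha_2}=\begin{bmatrix}0\\ \mathrm{id}\end{bmatrix}\colon k^r\to k^{r+1}$, where $\mathrm{id}=\mathrm{id}_{k^r}$. - $I_r$ has spaces $k^{r+1},k^r$ and maps $X_{\alpha_1}=\begin{bmatrix}\mathrm{id}&0\end{bmatrix}$, $X_{\alpha_2}=\begin{bmatrix}0&\mathrm{id}\end{bmatrix}\colon k^{r+1}\to k^r$, where $\mathrm{id}=\mathrm{id}_{k^r}$. $\mathbb P^1(k)$ is the set of pairs $(\lambda_0:\lambda_1)\neq(0:0)$ modulo scaling by non-zero elements of $k$. Let $J(p,\mu)$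 be the $p\times p$ Jordan block with eigenvalue $\mu$ (sending $e_i$ to $\mu e_i+e_{i-1}$, $e_0=0$). For $p\ge1$ and $\lambda\in\mathbb P^1(k)$, $R_{p,\lambda}$ has both spaces equal to $k^p$, with $(X_{\alpha_1},X_{\alpha_2})=(J(p,\lambda_0),\mathrm{id})$ if $\lambda=(\lambda_0:1)$, and $(X_{\alpha_1},X_{\alpha_2})=(\mathrm{id},J(p,\lambda_1))$ if $\lambda=(1:\lambda_1)$; when both descriptions apply the two representations are isomorphic, so $R_{p,\lambda}$ is well defined up to isomorphism. *)

theory Defs
  imports
    "HOL-Library.Function_Algebras"
    "HOL-Library.Product_Plus"
    "HOL-Computational_Algebra.Polynomial"
begin

section \<open>Representations of the Kronecker quiver\<close>

text \<open>
  A vector space is given as a subspace of an ambient vector space in the sense of the locale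
  \<^locale>\<open>vector_space\<close>. Every vector space arises in this way (take the whole type); the
  carriers are there because the dimension of $k^r$ has to vary within a statement. Maps are
  only relevant on the carriers.
\<close>

record ('k, 'a, 'b) kronecker_rep =
  scale1 :: "'k \<Rightarrow> 'a \<Rightarrow> 'a"
  space1 :: "'a set"
  scale2 :: "'k \<Rightarrow> 'b \<Rightarrow> 'b"
  space2 :: "'b set"
  arrow1 :: "'a \<Rightarrow> 'b"
  arrow2 :: "'a \<Rightarrow> 'b"

definition linear_between ::
  "('k::field \<Rightarrow> 'a::ab_group_add \<Rightarrow> 'a) \<Rightarrow> 'a set \<Rightarrow>
   ('k \<Rightarrow> 'b::ab_group_add \<Rightarrow> 'b) \<Rightarrow> 'b set \<Rightarrow> ('a \<Rightarrow> 'b) \<Rightarrow> bool" where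
  "linear_between s V t W f \<longleftrightarrow>
     (\<forall>x\<in>V. f x \<in> W) \<and>
     (\<forall>x\<in>V. \<forall>y\<in>V. f (x + y) = f x + f y) \<and>
     (\<forall>c. \<forall>x\<in>V. f (s c x) = t c (f x))"

definition is_rep :: "('k::field, 'a::ab_group_add, 'b::ab_group_add) kronecker_rep \<Rightarrow> bool" where
  "is_rep X \<longleftrightarrow>
     vector_space (scale1 X) \<and> module.subspace (scale1 X) (space1 X) \<and>
     vector_space (scale2 X) \<and> module.subspace (scale2 X) (space2 X) \<and>
     linear_between (scale1 X) (space1 X) (scale2 X) (space2 X) (arrow1 X) \<and>
     linear_between (scale1 X) (space1 X) (scale2 X) (space2 X) (arrow2 X)"

definition fin_dim_rep :: "('k::field, 'a::ab_group_add, 'b::ab_group_add) kronecker_rep \<Rightarrow> bool" where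
  "fin_dim_rep X \<longleftrightarrow>
     (\<exists>B. finite B \<and> space1 X = module.span (scale1 X) B) \<and>
     (\<exists>B. finite B \<and> space2 X = module.span (scale2 X) B)"

definition zero_rep :: "('k::field, 'a::ab_group_add, 'b::ab_group_add) kronecker_rep \<Rightarrow> bool" where
  "zero_rep X \<longleftrightarrow> space1 X = {0} \<and> space2 X = {0}"

definition rep_morphism ::
  "('k::field, 'a::ab_group_add, 'b::ab_group_add) kronecker_rep \<Rightarrow>
   ('k, 'c::ab_group_add, 'd::ab_group_add) kronecker_rep \<Rightarrow> ('a \<Rightarrow> 'c) \<Rightarrow> ('b \<Rightarrow> 'd) \<Rightarrow> bool" where
  "rep_morphism X Y \<phi>1 \<phi>2 \<longleftrightarrow>
     linear_between (scale1 X) (space1 X) (scale1 Y) (space1 Y) \<phi>1 \<and>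
     linear_between (scale2 X) (space2 X) (scale2 Y) (space2 Y) \<phi>2 \<and>
     (\<forall>x\<in>space1 X. arrow1 Y (\<phi>1 x) = \<phi>2 (arrow1 X x)) \<and>
     (\<forall>x\<in>space1 X. arrow2 Y (\<phi>1 x) = \<phi>2 (arrow2 X x))"

definition rep_iso ::
  "('k::field, 'a::ab_group_add, 'b::ab_group_add) kronecker_rep \<Rightarrow>
   ('k, 'c::ab_group_add, 'd::ab_group_add) kronecker_rep \<Rightarrow> bool" where
  "rep_iso X Y \<longleftrightarrow>
     (\<exists>\<phi>1 \<phi>2. rep_morphism X Y \<phi>1 \<phi>2 \<and>
        bij_betw \<phi>1 (space1 X) (space1 Y) \<and> bij_betw \<phi>2 (space2 X) (space2 Y))"

definition rep_sum ::
  "('k::field, 'a::ab_group_add, 'b::ab_group_add) kronecker_rep \<Rightarrow>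
   ('k, 'c::ab_group_add, 'd::ab_group_add) kronecker_rep \<Rightarrow> ('k, 'a \<times> 'c, 'b \<times> 'd) kronecker_rep" where
  "rep_sum Y Z =
     \<lparr>scale1 = (\<lambda>c. map_prod (scale1 Y c) (scale1 Z c)), space1 = space1 Y \<times> space1 Z,
      scale2 = (\<lambda>c. map_prod (scale2 Y c) (scale2 Z c)), space2 = space2 Y \<times> space2 Z,
      arrow1 = map_prod (arrow1 Y) (arrow1 Z),
      arrow2 = map_prod (arrow2 Y) (arrow2 Z)\<rparr>"

text \<open>
  The summands range over representations carried by the same types as \<open>X\<close>. This is no
  restriction, since summands of \<open>X\<close> embed into \<open>X\<close>; see \<open>not_indecomposable_sum\<close> below.
\<close>

definition indecomposable ::
  "('k::field, 'a::ab_group_add, 'b::ab_group_add) kronecker_rep \<Rightarrow> bool" where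
  "indecomposable X \<longleftrightarrow> is_rep X \<and> \<not> zero_rep X \<and>
     \<not> (\<exists>(Y :: ('k, 'a, 'b) kronecker_rep) (Z :: ('k, 'a, 'b) kronecker_rep).
           is_rep Y \<and> is_rep Z \<and> \<not> zero_rep Y \<and> \<not> zero_rep Z \<and> rep_iso X (rep_sum Y Z))"

lemma linear_between_zero:
  assumes "linear_between s V t W f" "module.subspace s V" "vector_space s"
  shows "f 0 = 0"
proof -
  interpret vector_space s by fact
  have "0 \<in> V" using assms(2) by (rule subspace_0)
  then have "f (0 + 0) = f 0 + f 0" using assms(1) unfolding linear_between_def by blast
  then show ?thesis by simp
qed

lemma split_along_iso:
  fixes s :: "'k::field \<Rightarrow> 'a::ab_group_add \<Rightarrow> 'a"
    and t :: "'k \<Rightarrow> 'c::ab_group_add \<Rightarrow> 'c" and u :: "'k \<Rightarrow> 'e::ab_group_add \<Rightarrow> 'e"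
  assumes s: "vector_space s" "module.subspace s V"
    and t: "vector_space t" "module.subspace t A"
    and u: "vector_space u" "module.subspace u B"
    and lin: "linear_between s V (\<lambda>c. map_prod (t c) (u c)) (A \<times> B) \<phi>"
    and bij: "bij_betw \<phi> V (A \<times> B)"
  defines "V1 \<equiv> {x \<in> V. snd (\<phi> x) = 0}" and "V2 \<equiv> {x \<in> V. fst (\<phi> x) = 0}"
  obtains p q where
    "module.subspace s V1" "module.subspace s V2"
    "linear_between s V s V1 p" "linear_between s V s V2 q"
    "bij_betw (\<lambda>x. (p x, q x)) V (V1 \<times> V2)"
    "\<And>x. x \<in> V \<Longrightarrow> \<phi> (p x) = (fst (\<phi> x), 0)"
    "\<And>x. x \<in> V \<Longrightarrow> \<phi> (q x) = (0, snd (\<phi> x))"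
    "A \<noteq> {0} \<Longrightarrow> V1 \<noteq> {0}" "B \<noteq> {0} \<Longrightarrow> V2 \<noteq> {0}"
proof -
  interpret s: vector_space s by (rule s(1))
  interpret t: vector_space t by (rule t(1))
  interpret u: vector_space u by (rule u(1))
  have phi_in: "\<phi> x \<in> A \<times> B" if "x \<in> V" for x
    using lin that by (auto simp: linear_between_def)
  have phi_add: "\<phi> (x + y) = \<phi> x + \<phi> y" if "x \<in> V" "y \<in> V" for x y
    using lin that by (auto simp: linear_between_def)
  have phi_scale: "\<phi> (s c x) = map_prod (t c) (u c) (\<phi> x)" if "x \<in> V" for c x
    using lin that by (auto simp: linear_between_def)
  have V_add: "x + y \<in> V" if "x \<in> V" "y \<in> V" for x y
    using s(2) that by (rule s.subspace_add)
  have V_scale: "s c x \<in> V" if "x \<in> V" for c x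
    using s(2) that by (rule s.subspace_scale)
  have V0: "0 \<in> V" using s(2) by (rule s.subspace_0)
  have A0: "0 \<in> A" using t(2) by (rule t.subspace_0)
  have B0: "0 \<in> B" using u(2) by (rule u.subspace_0)
  have "\<phi> (0 + 0) = \<phi> 0 + \<phi> 0" using V0 by (intro phi_add)
  then have phi0: "\<phi> 0 = 0" by simp
  have inj: "x = y" if "\<phi> x = \<phi> y" "x \<in> V" "y \<in> V" for x y
    using bij that by (auto simp: bij_betw_def inj_on_def)
  define g where "g = inv_into V \<phi>"
  have g_in: "g z \<in> V" if "z \<in> A \<times> B" for z
    using bij that unfolding g_def by (metis bij_betw_imp_surj_on inv_into_into)
  have phi_g: "\<phi> (g z) = z" if "z \<in> A \<times> B" for z
    using bij that unfolding g_def by (metis bij_betw_inv_into_right)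
  define p where "p x = g (fst (\<phi> x), 0)" for x
  define q where "q x = g (0, snd (\<phi> x))" for x
  have pz: "(fst (\<phi> x), 0) \<in> A \<times> B" and qz: "(0, snd (\<phi> x)) \<in> A \<times> B" if "x \<in> V" for x
    using phi_in[OF that] A0 B0 by auto
  have pV: "p x \<in> V" and qV: "q x \<in> V" if "x \<in> V" for x
    using g_in pz[OF that] qz[OF that] by (auto simp: p_def q_def)
  have phi_p: "\<phi> (p x) = (fst (\<phi> x), 0)" and phi_q: "\<phi> (q x) = (0, snd (\<phi> x))"
    if "x \<in> V" for x
    using phi_g pz[OF that] qz[OF that] by (auto simp: p_def q_def)
  show thesis
  proof (rule that[of p q])
    show "module.subspace s V1" "module.subspace s V2"
      by (simp_all add: s.subspace_def V1_def V2_def V0 V_add V_scale phi0 phi_add phi_scale)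
    show "linear_between s V s V1 p"
      unfolding linear_between_def
    proof (intro conjI ballI allI)
      fix x y c assume x: "x \<in> V" and y: "y \<in> V"
      show "p x \<in> V1" using x by (simp add: V1_def pV phi_p)
      show "p (x + y) = p x + p y"
        using x y by (intro inj) (simp_all add: pV phi_p V_add phi_add)
      show "p (s c x) = s c (p x)"
        using x by (intro inj) (simp_all add: pV phi_p V_scale phi_scale)
    qed
    show "linear_between s V s V2 q"
      unfolding linear_between_def
    proof (intro conjI ballI allI)
      fix x y c assume x: "x \<in> V" and y: "y \<in> V"
      show "q x \<in> V2" using x by (simp add: V2_def qV phi_q)
      show "q (x + y) = q x + q y"
        using x y by (intro inj) (simp_all add: qV phi_q V_add phi_add)
      show "q (s c x) = s c (q x)"
        using x by (intro inj) (simp_all add: qV phi_q V_scale phi_scale)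
    qed
    show "bij_betw (\<lambda>x. (p x, q x)) V (V1 \<times> V2)"
      unfolding bij_betw_def
    proof
      show "inj_on (\<lambda>x. (p x, q x)) V"
      proof (rule inj_onI)
        fix x y assume xy: "x \<in> V" "y \<in> V" and eq: "(p x, q x) = (p y, q y)"
        have "\<phi> x = \<phi> y"
          using eq phi_p[OF xy(1)] phi_p[OF xy(2)] phi_q[OF xy(1)] phi_q[OF xy(2)]
          by (simp add: prod_eq_iff)
        then show "x = y" using xy by (rule inj)
      qed
      show "(\<lambda>x. (p x, q x)) ` V = V1 \<times> V2"
      proof safe
        fix x assume "x \<in> V"
        then show "p x \<in> V1" "q x \<in> V2" by (auto simp: V1_def V2_def pV qV phi_p phi_q)
      next
        fix a b assume a: "a \<in> V1" and b: "b \<in> V2"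
        then have V: "a \<in> V" "b \<in> V" by (auto simp: V1_def V2_def)
        have "p (a + b) = a"
          using a b by (intro inj) (simp_all add: pV V V_add phi_p phi_add prod_eq_iff V1_def V2_def)
        moreover have "q (a + b) = b"
          using a b by (intro inj) (simp_all add: qV V V_add phi_q phi_add prod_eq_iff V1_def V2_def)
        ultimately show "(a, b) \<in> (\<lambda>x. (p x, q x)) ` V"
          using V_add[OF V] by (intro image_eqI[of _ _ "a + b"]) simp_all
      qed
    qed
    show "V1 \<noteq> {0}" if nz: "A \<noteq> {0}"
    proof -
      obtain y where y: "y \<in> A" "y \<noteq> 0" using A0 nz by blast
      then have "g (y, 0) \<in> V1" using B0 by (simp add: V1_def g_in phi_g)
      moreover have "g (y, 0) \<noteq> 0" using y B0 phi_g[of "(y, 0)"] phi0 by (auto simp: prod_eq_iff)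
      ultimately show ?thesis by blast
    qed
    show "V2 \<noteq> {0}" if nz: "B \<noteq> {0}"
    proof -
      obtain y where y: "y \<in> B" "y \<noteq> 0" using B0 nz by blast
      then have "g (0, y) \<in> V2" using A0 by (simp add: V2_def g_in phi_g)
      moreover have "g (0, y) \<noteq> 0" using y A0 phi_g[of "(0, y)"] phi0 by (auto simp: prod_eq_iff)
      ultimately show ?thesis by blast
    qed
  qed (use phi_p phi_q in auto)
qed

lemma not_indecomposable_sum:
  fixes X :: "('k::field, 'a::ab_group_add, 'b::ab_group_add) kronecker_rep"
    and Y :: "('k, 'c::ab_group_add, 'd::ab_group_add) kronecker_rep"
    and Z :: "('k, 'e::ab_group_add, 'f::ab_group_add) kronecker_rep"
  assumes X: "is_rep X" and Y: "is_rep Y" "\<not> zero_rep Y" and Z: "is_rep Z" "\<not> zero_rep Z"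
    and iso: "rep_iso X (rep_sum Y Z)"
  shows "\<not> indecomposable X"
proof -
  obtain \<phi>1 \<phi>2 where mor: "rep_morphism X (rep_sum Y Z) \<phi>1 \<phi>2"
    and bij: "bij_betw \<phi>1 (space1 X) (space1 Y \<times> space1 Z)"
      "bij_betw \<phi>2 (space2 X) (space2 Y \<times> space2 Z)"
    using iso by (auto simp: rep_iso_def rep_sum_def)
  have lin: "linear_between (scale1 X) (space1 X) (\<lambda>c. map_prod (scale1 Y c) (scale1 Z c))
      (space1 Y \<times> space1 Z) \<phi>1"
    "linear_between (scale2 X) (space2 X) (\<lambda>c. map_prod (scale2 Y c) (scale2 Z c))
      (space2 Y \<times> space2 Z) \<phi>2"
    and comm: "\<And>x. x \<in> space1 X \<Longrightarrow> \<phi>2 (arrow1 X x) = map_prod (arrow1 Y) (arrow1 Z) (\<phi>1 x)"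
      "\<And>x. x \<in> space1 X \<Longrightarrow> \<phi>2 (arrow2 X x) = map_prod (arrow2 Y) (arrow2 Z) (\<phi>1 x)"
    using mor by (auto simp: rep_morphism_def rep_sum_def)
  define V1 where "V1 = {x \<in> space1 X. snd (\<phi>1 x) = 0}"
  define V2 where "V2 = {x \<in> space1 X. fst (\<phi>1 x) = 0}"
  define W1 where "W1 = {x \<in> space2 X. snd (\<phi>2 x) = 0}"
  define W2 where "W2 = {x \<in> space2 X. fst (\<phi>2 x) = 0}"
  have x: "vector_space (scale1 X)" "module.subspace (scale1 X) (space1 X)"
      "vector_space (scale2 X)" "module.subspace (scale2 X) (space2 X)"
      "linear_between (scale1 X) (space1 X) (scale2 X) (space2 X) (arrow1 X)"
      "linear_between (scale1 X) (space1 X) (scale2 X) (space2 X) (arrow2 X)"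
    and y: "vector_space (scale1 Y)" "module.subspace (scale1 Y) (space1 Y)"
      "vector_space (scale2 Y)" "module.subspace (scale2 Y) (space2 Y)"
      "linear_between (scale1 Y) (space1 Y) (scale2 Y) (space2 Y) (arrow1 Y)"
      "linear_between (scale1 Y) (space1 Y) (scale2 Y) (space2 Y) (arrow2 Y)"
    and z: "vector_space (scale1 Z)" "module.subspace (scale1 Z) (space1 Z)"
      "vector_space (scale2 Z)" "module.subspace (scale2 Z) (space2 Z)"
      "linear_between (scale1 Z) (space1 Z) (scale2 Z) (space2 Z) (arrow1 Z)"
      "linear_between (scale1 Z) (space1 Z) (scale2 Z) (space2 Z) (arrow2 Z)"
    using X Y(1) Z(1) by (auto simp: is_rep_def)
  have zero: "arrow1 Y 0 = 0" "arrow2 Y 0 = 0" "arrow1 Z 0 = 0" "arrow2 Z 0 = 0"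
    using y z linear_between_zero by blast+
  obtain p1 q1 where 1:
    "module.subspace (scale1 X) V1" "module.subspace (scale1 X) V2"
    "linear_between (scale1 X) (space1 X) (scale1 X) V1 p1"
    "linear_between (scale1 X) (space1 X) (scale1 X) V2 q1"
    "bij_betw (\<lambda>x. (p1 x, q1 x)) (space1 X) (V1 \<times> V2)"
    "\<And>x. x \<in> space1 X \<Longrightarrow> \<phi>1 (p1 x) = (fst (\<phi>1 x), 0)"
    "\<And>x. x \<in> space1 X \<Longrightarrow> \<phi>1 (q1 x) = (0, snd (\<phi>1 x))"
    "space1 Y \<noteq> {0} \<Longrightarrow> V1 \<noteq> {0}" "space1 Z \<noteq> {0} \<Longrightarrow> V2 \<noteq> {0}"
    using split_along_iso[OF x(1,2) y(1,2) z(1,2) lin(1) bij(1)] unfolding V1_def V2_def by blast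
  obtain p2 q2 where 2:
    "module.subspace (scale2 X) W1" "module.subspace (scale2 X) W2"
    "linear_between (scale2 X) (space2 X) (scale2 X) W1 p2"
    "linear_between (scale2 X) (space2 X) (scale2 X) W2 q2"
    "bij_betw (\<lambda>x. (p2 x, q2 x)) (space2 X) (W1 \<times> W2)"
    "\<And>x. x \<in> space2 X \<Longrightarrow> \<phi>2 (p2 x) = (fst (\<phi>2 x), 0)"
    "\<And>x. x \<in> space2 X \<Longrightarrow> \<phi>2 (q2 x) = (0, snd (\<phi>2 x))"
    "space2 Y \<noteq> {0} \<Longrightarrow> W1 \<noteq> {0}" "space2 Z \<noteq> {0} \<Longrightarrow> W2 \<noteq> {0}"
    using split_along_iso[OF x(3,4) y(3,4) z(3,4) lin(2) bij(2)] unfolding W1_def W2_def by blast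
  define Y' where "Y' = X\<lparr>space1 := V1, space2 := W1\<rparr>"
  define Z' where "Z' = X\<lparr>space1 := V2, space2 := W2\<rparr>"
  have pq_in: "p1 v \<in> space1 X" "q1 v \<in> space1 X" if "v \<in> space1 X" for v
    using 1(3,4) that by (auto simp: linear_between_def V1_def V2_def)
  have pq_in2: "p2 v \<in> space2 X" "q2 v \<in> space2 X" if "v \<in> space2 X" for v
    using 2(3,4) that by (auto simp: linear_between_def W1_def W2_def)
  have arr_in: "arrow1 X v \<in> space2 X" "arrow2 X v \<in> space2 X" if "v \<in> space1 X" for v
    using x(5,6) that by (auto simp: linear_between_def)
  have inj2: "a = b" if "\<phi>2 a = \<phi>2 b" "a \<in> space2 X" "b \<in> space2 X" for a b
    using bij(2) that by (auto simp: bij_betw_def inj_on_def)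
  have sub: "linear_between (scale1 X) V (scale2 X) W f"
    if "linear_between (scale1 X) (space1 X) (scale2 X) (space2 X) f" "V \<subseteq> space1 X"
      "\<And>v. v \<in> V \<Longrightarrow> f v \<in> W" for f V W
    using that unfolding linear_between_def by blast
  have V: "V1 \<subseteq> space1 X" "V2 \<subseteq> space1 X" by (auto simp: V1_def V2_def)
  have arr: "\<And>v. v \<in> V1 \<Longrightarrow> arrow1 X v \<in> W1" "\<And>v. v \<in> V1 \<Longrightarrow> arrow2 X v \<in> W1"
    "\<And>v. v \<in> V2 \<Longrightarrow> arrow1 X v \<in> W2" "\<And>v. v \<in> V2 \<Longrightarrow> arrow2 X v \<in> W2"
    by (auto simp: V1_def V2_def W1_def W2_def comm arr_in zero)
  have "is_rep Y'" "is_rep Z'"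
    using 1(1,2) 2(1,2) x(1,3) sub[OF x(5) V(1) arr(1)] sub[OF x(6) V(1) arr(2)]
      sub[OF x(5) V(2) arr(3)] sub[OF x(6) V(2) arr(4)]
    by (simp_all add: is_rep_def Y'_def Z'_def)
  moreover have "\<not> zero_rep Y'" "\<not> zero_rep Z'"
    using Y(2) Z(2) 1(8,9) 2(8,9) unfolding zero_rep_def Y'_def Z'_def by (simp, blast)+
  moreover have "rep_iso X (rep_sum Y' Z')"
    unfolding rep_iso_def
  proof (intro exI conjI)
    have "p2 (arrow1 X v) = arrow1 X (p1 v)" "q2 (arrow1 X v) = arrow1 X (q1 v)"
      "p2 (arrow2 X v) = arrow2 X (p1 v)" "q2 (arrow2 X v) = arrow2 X (q1 v)"
      if "v \<in> space1 X" for v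
      using that by (intro inj2; simp add: pq_in pq_in2 arr_in comm zero 1(6,7) 2(6,7))+
    then show "rep_morphism X (rep_sum Y' Z') (\<lambda>v. (p1 v, q1 v)) (\<lambda>v. (p2 v, q2 v))"
      using 1(3,4) 2(3,4)
      by (auto simp: rep_morphism_def rep_sum_def Y'_def Z'_def linear_between_def)
  qed (use 1(5) 2(5) in \<open>simp_all add: rep_sum_def Y'_def Z'_def\<close>)
  ultimately show ?thesis unfolding indecomposable_def by blast
qed


section \<open>The representations in the list\<close>

text \<open>
  A vector of $k^r$ is a function \<^typ>\<open>nat \<Rightarrow> 'k\<close> vanishing at all indices $\ge r$; the
  coordinates are numbered from 0.
\<close>

definition coord_scale :: "'k::field \<Rightarrow> (nat \<Rightarrow> 'k) \<Rightarrow> nat \<Rightarrow> 'k" where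
  "coord_scale c v = (\<lambda>i. c * v i)"

definition coord_space :: "nat \<Rightarrow> (nat \<Rightarrow> 'k::field) set" where
  "coord_space r = {v. \<forall>i\<ge>r. v i = 0}"

definition coord_rep ::
  "nat \<Rightarrow> nat \<Rightarrow> ((nat \<Rightarrow> 'k::field) \<Rightarrow> nat \<Rightarrow> 'k) \<Rightarrow> ((nat \<Rightarrow> 'k) \<Rightarrow> nat \<Rightarrow> 'k) \<Rightarrow>
   ('k, nat \<Rightarrow> 'k, nat \<Rightarrow> 'k) kronecker_rep" where
  "coord_rep m n f g =
     \<lparr>scale1 = coord_scale, space1 = coord_space m, scale2 = coord_scale, space2 = coord_space n,
      arrow1 = f, arrow2 = g\<rparr>"

text \<open>
  $k^r \to k^{r+1}$: appending a zero coordinate changes nothing in this encoding of vectors,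
  prepending one is a shift.
\<close>

definition P_rep :: "nat \<Rightarrow> ('k::field, nat \<Rightarrow> 'k, nat \<Rightarrow> 'k) kronecker_rep" where
  "P_rep r = coord_rep r (r + 1) (\<lambda>v. v) (\<lambda>v i. if i = 0 then 0 else v (i - 1))"

text \<open>$k^{r+1} \to k^r$: dropping the last, respectively the first, coordinate.\<close>

definition I_rep :: "nat \<Rightarrow> ('k::field, nat \<Rightarrow> 'k, nat \<Rightarrow> 'k) kronecker_rep" where
  "I_rep r = coord_rep (r + 1) r (\<lambda>v i. if i < r then v i else 0) (\<lambda>v i. v (i + 1))"

text \<open>
  Coordinate \<open>i\<close> of the image of \<open>v\<close> under the Jordan block with $e_i \mapsto \mu e_i + e_{i-1}$.
  On $k^p$ the last coordinate comes out as $\mu v_{p-1}$ because $v_p = 0$, so the formula does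
  not mention \<open>p\<close>.
\<close>

definition jordan_map :: "'k::field \<Rightarrow> (nat \<Rightarrow> 'k) \<Rightarrow> nat \<Rightarrow> 'k" where
  "jordan_map \<mu> v = (\<lambda>i. \<mu> * v i + v (i + 1))"

definition proj_rel :: "(('k::field \<times> 'k) \<times> ('k \<times> 'k)) set" where
  "proj_rel = {(u, v). u \<noteq> (0, 0) \<and> v \<noteq> (0, 0) \<and>
     (\<exists>c. c \<noteq> 0 \<and> v = (c * fst u, c * snd u))}"

definition proj_line :: "('k::field \<times> 'k) set set" where
  "proj_line = {v. v \<noteq> (0, 0)} // proj_rel"

definition proj_point :: "'k::field \<Rightarrow> 'k \<Rightarrow> ('k \<times> 'k) set" where
  "proj_point a b = proj_rel `` {(a, b)}"

text \<open>
  The set of representations by which $R_{p,\lambda}$ is described: one for $\lambda = (0:1)$ and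
  $\lambda = (1:0)$, and two (isomorphic) ones for every other point.
\<close>

definition R_reps ::
  "nat \<Rightarrow> ('k::field \<times> 'k) set \<Rightarrow> ('k, nat \<Rightarrow> 'k, nat \<Rightarrow> 'k) kronecker_rep set" where
  "R_reps p l =
     {coord_rep p p (jordan_map a) (\<lambda>v. v) | a. l = proj_point a 1} \<union>
     {coord_rep p p (\<lambda>v. v) (jordan_map b) | b. l = proj_point 1 b}"

end

theory Submission
  imports Defs
begin

text \<open>
  A representation is a pencil of linear maps $A, B \colon V \to W$. Everything rests on splitting off
  direct summands by retractions: if $f \colon Y \to X$ and $g \colon X \to Y$ are morphisms with \<open>g \<circ> f\<close>
  bijective, then the kernel of \<open>g\<close> is a complement of the image of \<open>f\<close>, so an indecomposable $X$ is
  isomorphic to $Y$ (\<open>indecomposable_retract\<close>). Applied to the image of a high power of an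
  endomorphism of $X$, this gives Fitting's lemma (\<open>fitting\<close>): an endomorphism of an indecomposable
  representation that has a kernel is nilpotent.

  The representations in the list are indecomposable because the only endomorphisms of $P_r$ and $I_r$
  are scalars, and because all non-zero invariant subspaces of a Jordan block contain its eigenvector,
  so that no two of them are complementary.

  Conversely, let $X$ be indecomposable; choose bases, so that transposition is available. There are
  three cases.

  If no $A - \mu B$ is injective, choose kernel vectors for many different $\mu$. Suitable linear
  combinations of them yield a non-zero polynomial $v_0 + v_1 z + \dots + v_r z^r$ in the kernel of
  $z A - B$ (\<open>singular_pencil_has_chain\<close>), which is the same thing as a non-zero morphism from $I_r$ to
  $X$. If its degree $r$ is minimal, then there is a morphism from $X$ to $I_r$ that does not vanish on
  it (\<open>chain_functional\<close>): the existence of such a morphism is a question of linear algebra, and the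
  obstruction to it would be a shorter polynomial. The composition $I_r \to X \to I_r$ is a non-zero
  scalar, so $X \cong I_r$.

  If no transpose of an $A - \mu B$ is injective, the same reasoning for the transposed pencil gives
  $X \cong P_r$.

  Otherwise $V$ and $W$ have the same dimension and some $C = A - \mu B$ is invertible. Fitting's lemma
  for the endomorphism given by $C^{-1} B$ shows that $A$ or $B$ is invertible
  (\<open>regular_pencil_invertible_arrow\<close>), which reduces the problem to a single operator $S$. It has an
  eigenvalue $b$, and \<open>S - b\<close> is nilpotent, again by Fitting's lemma. A cyclic subspace of maximal
  dimension has an invariant complement, so $S$ is a single Jordan block
  (\<open>indecomposable_operator_jordan\<close>).
\<close>

section \<open>Morphisms and direct summands\<close>

lemma linear_betweenD:
  assumes "linear_between s V t W f"
  shows "\<And>x. x \<in> V \<Longrightarrow> f x \<in> W"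
    and "\<And>x y. x \<in> V \<Longrightarrow> y \<in> V \<Longrightarrow> f (x + y) = f x + f y"
    and "\<And>c x. x \<in> V \<Longrightarrow> f (s c x) = t c (f x)"
  using assms by (auto simp: linear_between_def)

lemma linear_between_compose:
  "linear_between s V t W f \<Longrightarrow> linear_between t W u U g \<Longrightarrow> linear_between s V u U (\<lambda>x. g (f x))"
  by (simp add: linear_between_def)

lemma linear_between_ident: "linear_between s V s V (\<lambda>x. x)"
  by (simp add: linear_between_def)

lemma linear_between_diff:
  assumes f: "linear_between s V t W f" and s: "vector_space s" "module.subspace s V"
    and x: "x \<in> V" "y \<in> V"
  shows "f (x - y) = f x - f y"
proof -
  interpret vector_space s by fact
  have "x - y \<in> V" using s(2) x by (rule subspace_diff)
  then have "f (x - y + y) = f (x - y) + f y" using x by (intro linear_betweenD(2)[OF f])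
  then show ?thesis by simp
qed

lemma linear_between_inverse:
  assumes f: "linear_between s V t W f" and bij: "bij_betw f V W"
    and s: "vector_space s" "module.subspace s V"
  shows "linear_between t W s V (inv_into V f)"
proof -
  interpret vector_space s by fact
  let ?g = "inv_into V f"
  have gV: "?g y \<in> V" and fg: "f (?g y) = y" if "y \<in> W" for y
    using bij that by (auto simp: bij_betw_def inv_into_into f_inv_into_f)
  have gf: "?g (f x) = x" if "x \<in> V" for x
    using bij that by (simp add: bij_betw_def)
  show ?thesis
    unfolding linear_between_def
  proof (intro conjI ballI allI)
    fix x y c assume x: "x \<in> W" and y: "y \<in> W"
    show "?g x \<in> V" using x by (rule gV)
    have "?g x + ?g y \<in> V" using s(2) gV[OF x] gV[OF y] by (rule subspace_add)
    from gf[OF this] show "?g (x + y) = ?g x + ?g y"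
      using x y by (simp add: linear_betweenD(2)[OF f] gV fg)
    have "s c (?g x) \<in> V" using s(2) gV[OF x] by (rule subspace_scale)
    from gf[OF this] show "?g (t c x) = s c (?g x)"
      using x by (simp add: linear_betweenD(3)[OF f] gV fg)
  qed
qed

lemma is_repD:
  assumes "is_rep X"
  shows "vector_space (scale1 X)" "module.subspace (scale1 X) (space1 X)"
    "vector_space (scale2 X)" "module.subspace (scale2 X) (space2 X)"
    "linear_between (scale1 X) (space1 X) (scale2 X) (space2 X) (arrow1 X)"
    "linear_between (scale1 X) (space1 X) (scale2 X) (space2 X) (arrow2 X)"
  using assms by (auto simp: is_rep_def)

lemma rep_morphismD:
  assumes "rep_morphism X Y f g"
  shows "linear_between (scale1 X) (space1 X) (scale1 Y) (space1 Y) f"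
    "linear_between (scale2 X) (space2 X) (scale2 Y) (space2 Y) g"
    "\<And>x. x \<in> space1 X \<Longrightarrow> arrow1 Y (f x) = g (arrow1 X x)"
    "\<And>x. x \<in> space1 X \<Longrightarrow> arrow2 Y (f x) = g (arrow2 X x)"
  using assms by (auto simp: rep_morphism_def)

lemma rep_morphism_compose:
  assumes X: "is_rep X" and f: "rep_morphism X Y f1 f2" and g: "rep_morphism Y Z g1 g2"
  shows "rep_morphism X Z (\<lambda>x. g1 (f1 x)) (\<lambda>x. g2 (f2 x))"
proof -
  note f' = rep_morphismD[OF f] and g' = rep_morphismD[OF g]
  show ?thesis
    unfolding rep_morphism_def
    using linear_between_compose[OF f'(1) g'(1)] linear_between_compose[OF f'(2) g'(2)]
      linear_betweenD(1)[OF f'(1)] f'(3,4) g'(3,4)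
    by simp
qed

lemma rep_morphism_inverse:
  assumes X: "is_rep X" and f: "rep_morphism X Y f1 f2"
    and bij: "bij_betw f1 (space1 X) (space1 Y)" "bij_betw f2 (space2 X) (space2 Y)"
  shows "rep_morphism Y X (inv_into (space1 X) f1) (inv_into (space2 X) f2)"
proof -
  note x = is_repD[OF X] and f' = rep_morphismD[OF f]
  have comm: "a (inv_into (space1 X) f1 y) = inv_into (space2 X) f2 (b y)"
    if y: "y \<in> space1 Y" and a: "\<And>x. x \<in> space1 X \<Longrightarrow> a x \<in> space2 X"
      and ab: "\<And>x. x \<in> space1 X \<Longrightarrow> b (f1 x) = f2 (a x)" for a b y
  proof -
    let ?x = "inv_into (space1 X) f1 y"
    have x: "?x \<in> space1 X" "f1 ?x = y"
      using y bij(1) by (auto simp: bij_betw_def inv_into_into f_inv_into_f)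
    have "inv_into (space2 X) f2 (f2 (a ?x)) = a ?x"
      using bij(2) a[OF x(1)] by (simp add: bij_betw_def)
    with ab[OF x(1)] x(2) show ?thesis by simp
  qed
  show ?thesis
    unfolding rep_morphism_def
    using linear_between_inverse[OF f'(1) bij(1) x(1,2)] linear_between_inverse[OF f'(2) bij(2) x(3,4)]
      comm[of _ "arrow1 X" "arrow1 Y", OF _ linear_betweenD(1)[OF x(5)] f'(3)]
      comm[of _ "arrow2 X" "arrow2 Y", OF _ linear_betweenD(1)[OF x(6)] f'(4)]
    by blast
qed

lemma rep_iso_sym:
  assumes "is_rep X" "rep_iso X Y"
  shows "rep_iso Y X"
proof -
  obtain f1 f2 where f: "rep_morphism X Y f1 f2"
      "bij_betw f1 (space1 X) (space1 Y)" "bij_betw f2 (space2 X) (space2 Y)"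
    using assms(2) by (auto simp: rep_iso_def)
  show ?thesis
    unfolding rep_iso_def
    using rep_morphism_inverse[OF assms(1) f] bij_betw_inv_into[OF f(2)] bij_betw_inv_into[OF f(3)]
    by blast
qed

lemma rep_iso_trans:
  assumes X: "is_rep X" and XY: "rep_iso X Y" and YZ: "rep_iso Y Z"
  shows "rep_iso X Z"
proof -
  obtain f1 f2 where f: "rep_morphism X Y f1 f2"
      "bij_betw f1 (space1 X) (space1 Y)" "bij_betw f2 (space2 X) (space2 Y)"
    using XY by (auto simp: rep_iso_def)
  obtain g1 g2 where g: "rep_morphism Y Z g1 g2"
      "bij_betw g1 (space1 Y) (space1 Z)" "bij_betw g2 (space2 Y) (space2 Z)"
    using YZ by (auto simp: rep_iso_def)
  show ?thesis
    unfolding rep_iso_def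
    using rep_morphism_compose[OF X f(1) g(1)] bij_betw_trans[OF f(2) g(2)] bij_betw_trans[OF f(3) g(3)]
    by (auto simp: o_def)
qed

lemma zero_rep_iso:
  assumes "rep_iso X Y" "is_rep X" "zero_rep X" 
  shows "zero_rep Y"
proof -
  obtain f1 f2 where f: "rep_morphism X Y f1 f2"
      "bij_betw f1 (space1 X) (space1 Y)" "bij_betw f2 (space2 X) (space2 Y)"
    using assms(1) by (auto simp: rep_iso_def)
  note x = is_repD[OF assms(2)] and f' = rep_morphismD[OF f(1)]
  have "f1 0 = 0" "f2 0 = 0" using linear_between_zero x f'(1,2) by blast+
  then show ?thesis using f(2,3) assms(3) by (auto simp: zero_rep_def bij_betw_def)
qed

lemma indecomposable_iso:
  fixes X :: "('k::field, 'a::ab_group_add, 'b::ab_group_add) kronecker_rep"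
    and Y :: "('k, 'c::ab_group_add, 'd::ab_group_add) kronecker_rep"
  assumes X: "indecomposable X" and Y: "is_rep Y" and iso: "rep_iso X Y"
  shows "indecomposable Y"
proof -
  have x: "is_rep X" "\<not> zero_rep X" using X by (auto simp: indecomposable_def)
  have "\<not> zero_rep Y" using zero_rep_iso rep_iso_sym x iso Y by blast
  moreover have "\<not> rep_iso Y (rep_sum U Z)"
    if "is_rep U" "is_rep Z" "\<not> zero_rep U" "\<not> zero_rep Z" for U Z :: "('k, 'c, 'd) kronecker_rep"
    using not_indecomposable_sum[OF x(1) that(1,3,2,4)] rep_iso_trans[OF x(1) iso] X by blast
  ultimately show ?thesis using Y unfolding indecomposable_def by blast
qed

text \<open>
  The linear algebra behind a retraction: if \<open>g \<circ> f\<close> is the identity, a vector is determined by its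
  image under \<open>g\<close> and its component in the kernel of \<open>g\<close>.
\<close>

lemma split_along_retraction:
  assumes s: "vector_space s" "module.subspace s V" and t: "vector_space t" "module.subspace t U"
    and f: "linear_between t U s V f" and g: "linear_between s V t U g"
    and gf: "\<And>x. x \<in> U \<Longrightarrow> g (f x) = x"
  defines "K \<equiv> {x \<in> V. g x = 0}"
  shows "module.subspace s K" "linear_between s V s K (\<lambda>x. x - f (g x))"
    "bij_betw (\<lambda>x. (g x, x - f (g x))) V (U \<times> K)"
proof -
  interpret s: vector_space s by fact
  interpret t: vector_space t by fact
  note g' = linear_betweenD[OF g] and f' = linear_betweenD[OF f]
  have g0: "g 0 = 0" using linear_between_zero[OF g s(2,1)] .
  have f0: "f 0 = 0" using linear_between_zero[OF f t(2,1)] .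
  have gd: "g (x - y) = g x - g y" if "x \<in> V" "y \<in> V" for x y
    using linear_between_diff[OF g s that] .
  have pV: "x - f (g x) \<in> V" if "x \<in> V" for x
    using s.subspace_diff[OF s(2) that] that by (simp add: f' g')
  have pK: "x - f (g x) \<in> K" if "x \<in> V" for x
    using pV[OF that] that by (simp add: K_def gd gf f' g')
  show "module.subspace s K"
    using s.subspace_0[OF s(2)] s.subspace_add[OF s(2)] s.subspace_scale[OF s(2)]
    by (simp add: K_def s.subspace_def g0 g')
  show "linear_between s V s K (\<lambda>x. x - f (g x))"
    unfolding linear_between_def
    by (simp add: pK f' g' s.scale_right_diff_distrib)
  show "bij_betw (\<lambda>x. (g x, x - f (g x))) V (U \<times> K)"
  proof (rule bij_betw_byWitness[where f' = "\<lambda>(u, k). f u + k"])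
    show "\<forall>x\<in>V. (case (g x, x - f (g x)) of (u, k) \<Rightarrow> f u + k) = x" by simp
    show "\<forall>a\<in>U \<times> K. (\<lambda>x. (g x, x - f (g x))) (case a of (u, k) \<Rightarrow> f u + k) = a"
      by (auto simp: K_def g' f' gf)
    show "(\<lambda>x. (g x, x - f (g x))) ` V \<subseteq> U \<times> K" using pK g' by auto
    show "(\<lambda>(u, k). f u + k) ` (U \<times> K) \<subseteq> V"
      using s.subspace_add[OF s(2)] f' by (auto simp: K_def)
  qed
qed

text \<open>
  The kernel of \<open>g\<close> is a complement of the image of \<open>f\<close>, and an indecomposable representation
  leaves no room for one.
\<close>

lemma indecomposable_retract_ident:
  fixes X :: "('k::field, 'a::ab_group_add, 'b::ab_group_add) kronecker_rep"
    and Y :: "('k, 'c::ab_group_add, 'd::ab_group_add) kronecker_rep"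
  assumes X: "indecomposable X" and Y: "is_rep Y" "\<not> zero_rep Y"
    and f: "rep_morphism Y X f1 f2" and g: "rep_morphism X Y g1 g2"
    and gf: "\<And>x. x \<in> space1 Y \<Longrightarrow> g1 (f1 x) = x" "\<And>x. x \<in> space2 Y \<Longrightarrow> g2 (f2 x) = x"
  shows "bij_betw g1 (space1 X) (space1 Y) \<and> bij_betw g2 (space2 X) (space2 Y)"
proof -
  have rX: "is_rep X" using X by (simp add: indecomposable_def)
  note x = is_repD[OF rX] and y = is_repD[OF Y(1)]
  note f' = rep_morphismD[OF f] and g' = rep_morphismD[OF g]
  define K1 where "K1 = {x \<in> space1 X. g1 x = 0}"
  define K2 where "K2 = {x \<in> space2 X. g2 x = 0}"
  define Z where "Z = X\<lparr>space1 := K1, space2 := K2\<rparr>"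
  note s1 = split_along_retraction[OF x(1,2) y(1,2) f'(1) g'(1) gf(1), folded K1_def]
  note s2 = split_along_retraction[OF x(3,4) y(3,4) f'(2) g'(2) gf(2), folded K2_def]
  have y0: "arrow1 Y 0 = 0" "arrow2 Y 0 = 0" using linear_between_zero y by blast+
  have K: "arrow1 X v \<in> K2" "arrow2 X v \<in> K2" if "v \<in> K1" for v
    using that linear_betweenD(1)[OF x(5)] linear_betweenD(1)[OF x(6)] g'(3)[of v] g'(4)[of v] y0
    by (auto simp: K1_def K2_def)
  have lin: "linear_between (scale1 X) K1 (scale2 X) K2 h"
    if "linear_between (scale1 X) (space1 X) (scale2 X) (space2 X) h"
      "\<And>v. v \<in> K1 \<Longrightarrow> h v \<in> K2" for h
    using that unfolding linear_between_def K1_def by simp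
  have Z: "is_rep Z"
    unfolding is_rep_def Z_def using x s1(1) s2(1) lin[OF x(5) K(1)] lin[OF x(6) K(2)] by simp
  have "rep_iso X (rep_sum Y Z)"
    unfolding rep_iso_def
  proof (intro exI conjI)
    show "bij_betw (\<lambda>v. (g1 v, v - f1 (g1 v))) (space1 X) (space1 (rep_sum Y Z))"
      using s1(3) by (simp add: rep_sum_def Z_def)
    show "bij_betw (\<lambda>v. (g2 v, v - f2 (g2 v))) (space2 X) (space2 (rep_sum Y Z))"
      using s2(3) by (simp add: rep_sum_def Z_def)
    have comm: "h (v - f1 (g1 v)) = h v - f2 (g2 (h v))" if v: "v \<in> space1 X"
      and h: "linear_between (scale1 X) (space1 X) (scale2 X) (space2 X) h"
      and gh: "\<And>v. v \<in> space1 X \<Longrightarrow> h' (g1 v) = g2 (h v)"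
      and hf: "\<And>v. v \<in> space1 Y \<Longrightarrow> h (f1 v) = f2 (h' v)"
      for h h' v
    proof -
      have g1v: "g1 v \<in> space1 Y" using linear_betweenD(1)[OF g'(1) v] .
      then have "h (v - f1 (g1 v)) = h v - h (f1 (g1 v))"
        using linear_between_diff[OF h x(1,2) v] linear_betweenD(1)[OF f'(1)] by blast
      also have "h (f1 (g1 v)) = f2 (g2 (h v))" using hf[OF g1v] gh[OF v] by (rule trans[OF _ arg_cong])
      finally show ?thesis .
    qed
    show "rep_morphism X (rep_sum Y Z) (\<lambda>v. (g1 v, v - f1 (g1 v))) (\<lambda>v. (g2 v, v - f2 (g2 v)))"
      using s1(2) s2(2) g'(1,2) g'(3,4)
        comm[where h = "arrow1 X" and h' = "arrow1 Y", OF _ x(5) g'(3) f'(3)]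
        comm[where h = "arrow2 X" and h' = "arrow2 Y", OF _ x(6) g'(4) f'(4)]
      by (simp add: rep_morphism_def rep_sum_def Z_def linear_between_def)
  qed
  then have "zero_rep Z" using not_indecomposable_sum[OF rX Y Z] X by blast
  then have K0: "K1 = {0}" "K2 = {0}" by (simp_all add: zero_rep_def Z_def)
  have inj: "inj_on g V"
    if "vector_space s" "module.subspace s V" "linear_between s V t U g" "{x \<in> V. g x = 0} = {0}"
    for s :: "'k \<Rightarrow> 'e::ab_group_add \<Rightarrow> 'e" and t :: "'k \<Rightarrow> 'f::ab_group_add \<Rightarrow> 'f" and V U g
  proof (rule inj_onI)
    fix v w assume vw: "v \<in> V" "w \<in> V" "g v = g w"
    then have "v - w \<in> {x \<in> V. g x = 0}"
      using linear_between_diff[OF that(3,1,2) vw(1,2)] module.subspace_diff[OF _ that(2) vw(1,2)]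
        that(1) by (simp add: vector_space_def module_def)
    then show "v = w" using that(4) by simp
  qed
  have "x \<in> g1 ` space1 X" if "x \<in> space1 Y" for x
    using gf(1)[OF that] linear_betweenD(1)[OF f'(1) that] by (metis image_eqI)
  moreover have "x \<in> g2 ` space2 X" if "x \<in> space2 Y" for x
    using gf(2)[OF that] linear_betweenD(1)[OF f'(2) that] by (metis image_eqI)
  ultimately have "g1 ` space1 X = space1 Y" "g2 ` space2 X = space2 Y"
    using linear_betweenD(1)[OF g'(1)] linear_betweenD(1)[OF g'(2)] by blast+
  then show ?thesis
    using inj[OF x(1,2) g'(1)] inj[OF x(3,4) g'(2)] K0 by (simp add: bij_betw_def K1_def K2_def)
qed

text \<open>
  The version with \<open>g \<circ> f\<close> merely bijective follows by composing \<open>g\<close> with the inverse of \<open>g \<circ> f\<close>. It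
  yields both the classification, where \<open>Y\<close> is a Jordan block, and Fitting's lemma,
  where \<open>Y\<close> is the image of an endomorphism.
\<close>

lemma indecomposable_retract:
  fixes X :: "('k::field, 'a::ab_group_add, 'b::ab_group_add) kronecker_rep"
    and Y :: "('k, 'c::ab_group_add, 'd::ab_group_add) kronecker_rep"
  assumes X: "indecomposable X" and Y: "is_rep Y" "\<not> zero_rep Y"
    and f: "rep_morphism Y X f1 f2" and g: "rep_morphism X Y g1 g2"
    and bij: "bij_betw (\<lambda>x. g1 (f1 x)) (space1 Y) (space1 Y)"
      "bij_betw (\<lambda>x. g2 (f2 x)) (space2 Y) (space2 Y)"
  shows "bij_betw g1 (space1 X) (space1 Y)" "bij_betw g2 (space2 X) (space2 Y)"
proof -
  have rX: "is_rep X" using X by (simp add: indecomposable_def)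
  let ?h1 = "inv_into (space1 Y) (\<lambda>x. g1 (f1 x))" and ?h2 = "inv_into (space2 Y) (\<lambda>x. g2 (f2 x))"
  have h: "rep_morphism Y Y ?h1 ?h2"
    by (rule rep_morphism_inverse[OF Y(1) rep_morphism_compose[OF Y(1) f g] bij])
  have "?h1 (g1 (f1 x)) = x" if "x \<in> space1 Y" for x
    using bij(1) that by (metis bij_betw_inv_into_left)
  moreover have "?h2 (g2 (f2 x)) = x" if "x \<in> space2 Y" for x
    using bij(2) that by (metis bij_betw_inv_into_left)
  ultimately have b: "bij_betw (\<lambda>x. ?h1 (g1 x)) (space1 X) (space1 Y)"
      "bij_betw (\<lambda>x. ?h2 (g2 x)) (space2 X) (space2 Y)"
    using indecomposable_retract_ident[OF X Y f rep_morphism_compose[OF rX g h]] by blast+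
  have *: "bij_betw g V U" if b: "bij_betw (\<lambda>x. h (g x)) V U" and h: "bij_betw h U U" and g: "g ` V \<subseteq> U" for g h V U
  proof -
    have "inj_on g V" using b by (metis bij_betw_def inj_on_def)
    moreover have "U \<subseteq> g ` V"
    proof
      fix u assume u: "u \<in> U"
      then have "h u \<in> U" using h by (auto simp: bij_betw_def)
      then obtain v where v: "v \<in> V" "h (g v) = h u" using b by (metis (no_types, lifting) bij_betw_imp_surj_on image_iff)
      then have "g v = u" using h u g by (metis bij_betw_def image_subset_iff inj_onD)
      then show "u \<in> g ` V" using v by blast
    qed
    ultimately show ?thesis using g by (auto simp: bij_betw_def)
  qed
  show "bij_betw g1 (space1 X) (space1 Y)"
    using *[OF b(1) bij_betw_inv_into[OF bij(1)]] rep_morphismD(1)[OF g] by (auto simp: linear_between_def)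
  show "bij_betw g2 (space2 X) (space2 Y)"
    using *[OF b(2) bij_betw_inv_into[OF bij(2)]] rep_morphismD(2)[OF g] by (auto simp: linear_between_def)
qed

text \<open>The projection onto a summand is an idempotent endomorphism.\<close>

lemma indecomposable_if_no_idempotent:
  fixes X :: "('k::field, 'a::ab_group_add, 'b::ab_group_add) kronecker_rep"
  assumes X: "is_rep X" "\<not> zero_rep X"
    and idem: "\<And>e1 e2. \<lbrakk>rep_morphism X X e1 e2; \<forall>x\<in>space1 X. e1 (e1 x) = e1 x;
        \<forall>x\<in>space2 X. e2 (e2 x) = e2 x\<rbrakk>
      \<Longrightarrow> (\<forall>x\<in>space1 X. e1 x = 0) \<and> (\<forall>x\<in>space2 X. e2 x = 0) \<or>
         (\<forall>x\<in>space1 X. e1 x = x) \<and> (\<forall>x\<in>space2 X. e2 x = x)"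
  shows "indecomposable X"
  unfolding indecomposable_def
proof (intro conjI X, rule notI)
  assume "\<exists>(Y :: ('k, 'a, 'b) kronecker_rep) (Z :: ('k, 'a, 'b) kronecker_rep).
           is_rep Y \<and> is_rep Z \<and> \<not> zero_rep Y \<and> \<not> zero_rep Z \<and> rep_iso X (rep_sum Y Z)"
  then obtain Y Z :: "('k, 'a, 'b) kronecker_rep" where Y: "is_rep Y" "\<not> zero_rep Y"
    and Z: "is_rep Z" "\<not> zero_rep Z" and iso: "rep_iso X (rep_sum Y Z)" by blast
  obtain f1 f2 where f: "rep_morphism X (rep_sum Y Z) f1 f2"
    and bij: "bij_betw f1 (space1 X) (space1 (rep_sum Y Z))" "bij_betw f2 (space2 X) (space2 (rep_sum Y Z))"
    using iso by (auto simp: rep_iso_def)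
  let ?g1 = "inv_into (space1 X) f1" and ?g2 = "inv_into (space2 X) f2"
  let ?p = "\<lambda>z. (fst z, 0)"
  note x = is_repD[OF X(1)] and y = is_repD[OF Y(1)] and z = is_repD[OF Z(1)]
  interpret Z1: vector_space "scale1 Z" by (rule z(1))
  interpret Z2: vector_space "scale2 Z" by (rule z(3))
  interpret Y1: vector_space "scale1 Y" by (rule y(1))
  interpret Y2: vector_space "scale2 Y" by (rule y(3))
  have z0: "arrow1 Z 0 = 0" "arrow2 Z 0 = 0" using linear_between_zero z by blast+
  have 0: "0 \<in> space1 Y" "0 \<in> space2 Y" "0 \<in> space1 Z" "0 \<in> space2 Z"
    using Y1.subspace_0[OF y(2)] Y2.subspace_0[OF y(4)] Z1.subspace_0[OF z(2)] Z2.subspace_0[OF z(4)] .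
  have p: "rep_morphism (rep_sum Y Z) (rep_sum Y Z) ?p ?p"
    using 0 z0 by (auto simp: rep_morphism_def rep_sum_def linear_between_def)
  have g: "rep_morphism (rep_sum Y Z) X ?g1 ?g2" by (rule rep_morphism_inverse[OF X(1) f bij])
  have e: "rep_morphism X X (\<lambda>x. ?g1 (?p (f1 x))) (\<lambda>x. ?g2 (?p (f2 x)))"
    by (rule rep_morphism_compose[OF X(1) rep_morphism_compose[OF X(1) f p] g])
  have fg: "f1 (?g1 w) = w" if "w \<in> space1 (rep_sum Y Z)" for w
    using bij(1) that by (metis bij_betw_inv_into_right)
  have fg2: "f2 (?g2 w) = w" if "w \<in> space2 (rep_sum Y Z)" for w
    using bij(2) that by (metis bij_betw_inv_into_right)
  have pin: "?p (f1 x) \<in> space1 (rep_sum Y Z)" if "x \<in> space1 X" for x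
    using bij_betwE[OF bij(1)] that 0 by (fastforce simp: rep_sum_def)
  have pin2: "?p (f2 x) \<in> space2 (rep_sum Y Z)" if "x \<in> space2 X" for x
    using bij_betwE[OF bij(2)] that 0 by (fastforce simp: rep_sum_def)
  have g0: "?g1 (a, b) \<in> space1 X" "f1 (?g1 (a, b)) = (a, b)" if "a \<in> space1 Y" "b \<in> space1 Z" for a b
    using that fg bij(1) by (auto simp: rep_sum_def bij_betw_def inv_into_into)
  have g02: "?g2 (a, b) \<in> space2 X" "f2 (?g2 (a, b)) = (a, b)" if "a \<in> space2 Y" "b \<in> space2 Z" for a b
    using that fg2 bij(2) by (auto simp: rep_sum_def bij_betw_def inv_into_into)
  consider "\<forall>x\<in>space1 X. ?g1 (?p (f1 x)) = 0" "\<forall>x\<in>space2 X. ?g2 (?p (f2 x)) = 0"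
    | "\<forall>x\<in>space1 X. ?g1 (?p (f1 x)) = x" "\<forall>x\<in>space2 X. ?g2 (?p (f2 x)) = x"
    using idem[OF e] pin pin2 by (auto simp: fg fg2)
  then show False
  proof cases
    case 1
    have f0: "f1 0 = 0" "f2 0 = 0"
      using linear_between_zero[OF rep_morphismD(1)[OF f] x(2,1)]
        linear_between_zero[OF rep_morphismD(2)[OF f] x(4,3)] .
    have "a = 0" if "a \<in> space1 Y" for a
      using 1(1) g0[OF that 0(3)] f0 by (force simp: prod_eq_iff)
    moreover have "a = 0" if "a \<in> space2 Y" for a
      using 1(2) g02[OF that 0(4)] f0 by (force simp: prod_eq_iff)
    ultimately show False using Y(2) 0 by (auto simp: zero_rep_def)
  next
    case 2
    have "b = 0" if "b \<in> space1 Z" for b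
      using 2(1) g0[OF 0(1) that] fg[OF pin[OF g0(1)[OF 0(1) that]]] by (force simp: prod_eq_iff)
    moreover have "b = 0" if "b \<in> space2 Z" for b
      using 2(2) g02[OF 0(2) that] fg2[OF pin2[OF g02(1)[OF 0(2) that]]] by (force simp: prod_eq_iff)
    ultimately show False using Z(2) 0 by (auto simp: zero_rep_def)
  qed
qed

section \<open>Linear algebra in coordinates\<close>

abbreviation coord_linear ::
  "nat \<Rightarrow> nat \<Rightarrow> ((nat \<Rightarrow> 'k::field) \<Rightarrow> nat \<Rightarrow> 'k) \<Rightarrow> bool" where
  "coord_linear m n f \<equiv> linear_between coord_scale (coord_space m) coord_scale (coord_space n) f"

abbreviation unit_vec :: "nat \<Rightarrow> nat \<Rightarrow> 'k::field" where
  "unit_vec i \<equiv> (\<lambda>j. if j = i then 1 else 0)"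

lemma coord_scale_apply [simp]: "coord_scale c v i = c * v i"
  by (simp add: coord_scale_def)

interpretation coord: vector_space "coord_scale :: 'k::field \<Rightarrow> _"
  by unfold_locales (auto simp: fun_eq_iff algebra_simps)

lemma subspace_coord_space: "coord.subspace (coord_space m)"
  by (simp add: coord.subspace_def coord_space_def)

lemma coord_space_closed [simp, intro]:
  "0 \<in> coord_space m"
  "v \<in> coord_space m \<Longrightarrow> w \<in> coord_space m \<Longrightarrow> v + w \<in> coord_space m"
  "v \<in> coord_space m \<Longrightarrow> w \<in> coord_space m \<Longrightarrow> v - w \<in> coord_space m"
  "v \<in> coord_space m \<Longrightarrow> coord_scale c v \<in> coord_space m"
  by (simp_all add: coord_space_def)

lemma unit_vec_in_coord_space [simp]: "unit_vec i \<in> coord_space m \<longleftrightarrow> i < m"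
  by (auto simp: coord_space_def)

lemma sum_fun_at: "(\<Sum>i\<in>I. v i) j = (\<Sum>i\<in>I. v i j)" for v :: "'i \<Rightarrow> nat \<Rightarrow> 'k::field"
  by (induction I rule: infinite_finite_induct) auto

lemma coord_space_sum:
  "(\<And>i. i \<in> I \<Longrightarrow> v i \<in> coord_space m) \<Longrightarrow> (\<Sum>i\<in>I. v i) \<in> coord_space m"
  by (rule coord.subspace_sum[OF subspace_coord_space])

lemma coord_expand:
  assumes "x \<in> coord_space m"
  shows "x = (\<Sum>i<m. coord_scale (x i) (unit_vec i))"
proof
  fix j
  have "(\<Sum>i<m. x i * (if j = i then 1 else 0)) = (if j < m then x j else 0)"
    by (simp add: if_distrib[of "\<lambda>u. _ * u"] cong: if_cong)
  then show "x j = (\<Sum>i<m. coord_scale (x i) (unit_vec i)) j"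
    using assms by (simp add: sum_fun_at coord_space_def)
qed

lemma coord_space_eq_span: "(coord_space m :: (nat \<Rightarrow> 'k::field) set) = coord.span (unit_vec ` {..<m})"
  (is "?V = ?S")
proof
  show "?V \<subseteq> ?S"
  proof
    fix x :: "nat \<Rightarrow> 'k" assume x: "x \<in> coord_space m"
    have "(\<Sum>i<m. coord_scale (x i) (unit_vec i)) \<in> coord.span (unit_vec ` {..<m})"
      by (intro coord.span_sum coord.span_scale coord.span_base) simp
    then show "x \<in> coord.span (unit_vec ` {..<m})" by (simp only: coord_expand[OF x, symmetric])
  qed
  show "?S \<subseteq> ?V"
    by (rule coord.span_minimal) (auto simp: subspace_coord_space)
qed

lemma coord_space_trivial_iff: "coord_space m = {0 :: nat \<Rightarrow> 'k::field} \<longleftrightarrow> m = 0"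
proof
  assume "coord_space m = {0 :: nat \<Rightarrow> 'k}"
  then have "unit_vec 0 \<notin> (coord_space m :: (nat \<Rightarrow> 'k) set)" by (auto simp: fun_eq_iff)
  then show "m = 0" by simp
qed (auto simp: coord_space_def)

lemma linear_sum:
  assumes "coord_linear m n f" and "\<And>i. i \<in> I \<Longrightarrow> v i \<in> coord_space m"
  shows "f (\<Sum>i\<in>I. coord_scale (c i) (v i)) = (\<Sum>i\<in>I. coord_scale (c i) (f (v i)))"
  using assms(2)
proof (induction I rule: infinite_finite_induct)
  case (insert i I)
  have "(\<Sum>i\<in>I. coord_scale (c i) (v i)) \<in> coord_space m"
    using insert.prems by (intro coord_space_sum) auto
  with insert show ?case
    by (simp add: linear_betweenD[OF assms(1)] del: coord_scale_apply plus_fun_apply)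
qed (simp_all add: linear_between_zero[OF assms(1) subspace_coord_space coord.vector_space_axioms])

lemma linear_zero: "coord_linear m n f \<Longrightarrow> f 0 = 0"
  by (rule linear_between_zero[OF _ subspace_coord_space coord.vector_space_axioms])

lemma linear_diff:
  "coord_linear m n f \<Longrightarrow> x \<in> coord_space m \<Longrightarrow> y \<in> coord_space m \<Longrightarrow> f (x - y) = f x - f y"
  by (rule linear_between_diff[OF _ coord.vector_space_axioms subspace_coord_space])

lemma linear_eqI:
  assumes f: "coord_linear m n f" and g: "coord_linear m n g"
    and eq: "\<And>i. i < m \<Longrightarrow> f (unit_vec i) = g (unit_vec i)" and x: "x \<in> coord_space m"
  shows "f x = g x"
proof -
  have "f x = (\<Sum>i<m. coord_scale (x i) (f (unit_vec i)))"
    by (subst coord_expand[OF x], rule linear_sum[OF f]) simp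
  also have "\<dots> = (\<Sum>i<m. coord_scale (x i) (g (unit_vec i)))" by (simp add: eq)
  also have "\<dots> = g x"
    by (subst (2) coord_expand[OF x], rule linear_sum[OF g, symmetric]) simp
  finally show ?thesis .
qed

lemma linear_funpow: "coord_linear m m f \<Longrightarrow> coord_linear m m (f ^^ N)"
  by (induction N) (auto simp: linear_between_def)

lemma least_nonzero:
  fixes c :: "nat \<Rightarrow> 'k::zero"
  assumes "\<exists>i<N. c i \<noteq> 0"
  obtains a where "a < N" "c a \<noteq> 0" "\<And>i. i < a \<Longrightarrow> c i = 0"
proof -
  obtain a where a: "a < N \<and> c a \<noteq> 0" "\<forall>i<a. \<not> (i < N \<and> c i \<noteq> 0)"
    using assms exists_least_iff[of "\<lambda>i. i < N \<and> c i \<noteq> 0"] by auto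
  then show ?thesis by (intro that[of a]) (auto dest: less_trans)
qed

text \<open>
  The vectors form a family: a repetition among them is a linear relation, although the set of the
  vectors may be linearly independent.
\<close>

lemma coord_dependent:
  fixes v :: "nat \<Rightarrow> nat \<Rightarrow> 'k::field"
  assumes v: "\<And>i. i < N \<Longrightarrow> v i \<in> coord_space M" and MN: "M < N"
  obtains c where "\<exists>i<N. c i \<noteq> 0" "(\<Sum>i<N. coord_scale (c i) (v i)) = 0"
proof (cases "inj_on v {..<N}")
  case True
  have "\<not> coord.independent (v ` {..<N})"
  proof
    assume "coord.independent (v ` {..<N})"
    then have "card (v ` {..<N}) \<le> card ((unit_vec :: nat \<Rightarrow> nat \<Rightarrow> 'k) ` {..<M})"
      using coord.independent_span_bound[of "unit_vec ` {..<M}" "v ` {..<N}"] v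
      by (auto simp: coord_space_eq_span[symmetric])
    also have "\<dots> \<le> M" using card_image_le[of "{..<M}"] by simp
    finally show False using MN True by (simp add: card_image)
  qed
  then obtain u where u: "\<exists>x\<in>v ` {..<N}. u x \<noteq> 0" "(\<Sum>x\<in>v ` {..<N}. coord_scale (u x) x) = 0"
    by (auto simp: coord.dependent_finite)
  show ?thesis
    by (rule that[of "\<lambda>i. u (v i)"]) (use u True in \<open>auto simp: sum.reindex\<close>)
next
  case False
  then obtain i j where ij: "i < N" "j < N" "i \<noteq> j" "v i = v j" by (auto simp: inj_on_def)
  have "(\<Sum>l<N. coord_scale (if l = i then 1 else if l = j then - 1 else 0) (v l)) =
      (\<Sum>l\<in>{i, j}. coord_scale (if l = i then 1 else if l = j then - 1 else 0) (v l))"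
    by (rule sum.mono_neutral_right) (use ij in auto)
  also have "\<dots> = 0" using ij by simp
  finally show ?thesis
    by (intro that[of "\<lambda>l. if l = i then 1 else if l = j then - 1 else 0"]) (use ij in auto)
qed

text \<open>
  A linear relation between \<open>y\<close>, \<open>f y\<close>, \<open>f (f y)\<close>, \<dots> expresses its first term with non-zero
  coefficient through images under \<open>f\<close>; by injectivity that term may be taken to be \<open>y\<close> itself.
\<close>

lemma injective_self_map_surj:
  assumes U: "coord.subspace U" "U \<subseteq> coord_space m"
    and f: "linear_between coord_scale U coord_scale U f"
    and inj: "\<And>x. x \<in> U \<Longrightarrow> f x = 0 \<Longrightarrow> x = 0"
  shows "bij_betw f U U"
proof -
  have fU: "f x \<in> U" if "x \<in> U" for x using linear_betweenD(1)[OF f that] .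
  have f0: "f 0 = 0" using linear_between_zero[OF f U(1) coord.vector_space_axioms] .
  have fsum: "f (\<Sum>i\<in>I. coord_scale (c i) (v i)) = (\<Sum>i\<in>I. coord_scale (c i) (f (v i)))"
    if "\<And>i. i \<in> I \<Longrightarrow> v i \<in> U" for I :: "nat set" and c v
    using that
  proof (induction I rule: infinite_finite_induct)
    case (insert i I)
    have "(\<Sum>i\<in>I. coord_scale (c i) (v i)) \<in> U"
      using insert.prems by (intro coord.subspace_sum[OF U(1)] coord.subspace_scale[OF U(1)]) auto
    with insert show ?case
      by (simp add: linear_betweenD[OF f] coord.subspace_scale[OF U(1)] del: coord_scale_apply plus_fun_apply)
  qed (simp_all add: f0)
  have pow: "(f ^^ i) x \<in> U" if "x \<in> U" for i x using that by (induction i) (auto simp: fU)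
  have "y \<in> f ` U" if y: "y \<in> U" for y
  proof -
    obtain c where c: "\<exists>i<Suc m. c i \<noteq> 0" "(\<Sum>i<Suc m. coord_scale (c i) ((f ^^ i) y)) = 0"
      by (rule coord_dependent[of "Suc m" "\<lambda>i. (f ^^ i) y" m]) (use pow[OF y] U(2) in auto)
    obtain a where a: "c a \<noteq> 0" "a \<le> m" and small: "\<And>i. i < a \<Longrightarrow> c i = 0"
      using least_nonzero[OF c(1)] unfolding less_Suc_eq_le by blast
    have inj_pow: "x = 0" if "x \<in> U" "(f ^^ i) x = 0" for i x
      using that by (induction i) (auto dest!: inj[OF pow])
    have fsum_pow: "(f ^^ j) (\<Sum>i\<in>I. coord_scale (c i) (v i)) = (\<Sum>i\<in>I. coord_scale (c i) ((f ^^ j) (v i)))"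
      if "\<And>i. i \<in> I \<Longrightarrow> v i \<in> U" for I :: "nat set" and c v j
      by (induction j) (simp_all add: fsum pow that del: coord_scale_apply)
    let ?z = "\<Sum>i\<in>{..<Suc m - a}. coord_scale (c (i + a)) ((f ^^ i) y)"
    have "(f ^^ a) ?z = (\<Sum>i\<in>{..<Suc m - a}. coord_scale (c (i + a)) ((f ^^ (i + a)) y))"
      by (subst fsum_pow) (simp_all add: pow y funpow_add[symmetric, THEN fun_cong, unfolded o_apply] add.commute)
    also have "\<dots> = (\<Sum>i\<in>{a..<Suc m}. coord_scale (c i) ((f ^^ i) y))"
      by (rule sum.reindex_bij_witness[of _ "\<lambda>i. i - a" "\<lambda>i. i + a"]) (use a(2) in auto)
    also have "\<dots> = (\<Sum>i<Suc m. coord_scale (c i) ((f ^^ i) y))"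
      by (rule sum.mono_neutral_left) (use small in auto)
    finally have "(f ^^ a) ?z = 0" using c(2) by simp
    moreover have "?z \<in> U"
      by (intro coord.subspace_sum[OF U(1)] coord.subspace_scale[OF U(1)] pow y)
    ultimately have z: "?z = 0" by (rule inj_pow[rotated])
    let ?w = "\<Sum>i\<in>{..<m - a}. coord_scale (c (Suc i + a)) ((f ^^ i) y)"
    have wU: "?w \<in> U" by (intro coord.subspace_sum[OF U(1)] coord.subspace_scale[OF U(1)] pow y)
    have "f ?w = (\<Sum>i<m - a. coord_scale (c (Suc i + a)) ((f ^^ Suc i) y))"
      by (subst fsum) (simp_all add: pow y del: coord_scale_apply)
    moreover have "Suc m - a = Suc (m - a)" using a(2) by simp
    ultimately have "?z = coord_scale (c a) y + f ?w"
      by (simp only: sum.lessThan_Suc_shift) simp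
    then have "coord_scale (c a) y + f ?w = 0" using z by simp
    then have "- f ?w = coord_scale (c a) y" by (rule eq_neg_iff_add_eq_0[THEN iffD2, symmetric])
    then have "coord_scale (inverse (c a)) (- f ?w) = y" using a(1) by (simp only: coord.scale_scale) simp
    then have "y = coord_scale (- inverse (c a)) (f ?w)"
      by (simp only: coord.scale_minus_left coord.scale_minus_right)
    then have "y = f (coord_scale (- inverse (c a)) ?w)"
      by (simp only: linear_betweenD(3)[OF f wU])
    then show ?thesis using wU coord.subspace_scale[OF U(1)] by blast
  qed
  moreover have "inj_on f U"
  proof (rule inj_onI)
    fix x y assume xy: "x \<in> U" "y \<in> U" "f x = f y"
    then have "f (x - y) = 0"
      using linear_between_diff[OF f coord.vector_space_axioms U(1)] by simp
    then show "x = y" using inj[of "x - y"] coord.subspace_diff[OF U(1)] xy by simp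
  qed
  ultimately show ?thesis using fU by (auto simp: bij_betw_def)
qed

lemma linear_injective_bij:
  assumes "coord_linear m m f" and "\<And>x. x \<in> coord_space m \<Longrightarrow> f x = 0 \<Longrightarrow> x = 0"
  shows "bij_betw f (coord_space m) (coord_space m)"
  by (rule injective_self_map_surj[OF subspace_coord_space order_refl assms])

text \<open>
  This bound and its transpose force the two spaces of a pencil without singular summands to have
  the same dimension.
\<close>

lemma injective_dim_le:
  assumes f: "coord_linear m n f" and inj: "\<And>x. x \<in> coord_space m \<Longrightarrow> f x = 0 \<Longrightarrow> x = 0"
  shows "m \<le> n"
proof (rule ccontr)
  assume "\<not> m \<le> n"
  then have nm: "n < m" by simp
  obtain c where c: "\<exists>i<m. c i \<noteq> 0" "(\<Sum>i<m. coord_scale (c i) (f (unit_vec i))) = 0"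
    by (rule coord_dependent[of m "\<lambda>i. f (unit_vec i)" n, OF linear_betweenD(1)[OF f] nm]) simp_all
  let ?x = "\<Sum>i<m. coord_scale (c i) (unit_vec i)"
  have x: "?x \<in> coord_space m" by (rule coord_space_sum) auto
  have "f ?x = 0" using c(2) by (subst linear_sum[OF f]) auto
  then have "?x = 0" using inj x by blast
  moreover obtain i where i: "i < m" "c i \<noteq> 0" using c(1) by blast
  moreover have "?x i = c i"
    using i by (simp add: sum_fun_at if_distrib[of "\<lambda>u. _ * u"] cong: if_cong)
  ultimately show False by simp
qed

text \<open>
  If \<open>f ^^ Suc m\<close> killed \<open>y\<close> but \<open>f ^^ m\<close> did not, then \<open>y\<close>, \<open>f y\<close>, \<dots>, \<open>(f ^^ m) y\<close> would be \<open>m + 1\<close>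
  linearly independent vectors in $k^m$: apply a suitable power of \<open>f\<close> to a linear relation to isolate
  its first non-zero coefficient.
\<close>

lemma kernel_of_power_stable:
  assumes f: "coord_linear m m f" and x: "x \<in> coord_space m" and "m \<le> N" "(f ^^ (N + k)) x = 0"
  shows "(f ^^ N) x = 0"
  using assms(4)
proof (induction k)
  case (Suc k)
  define y where "y = (f ^^ (N + k - m)) x"
  have pow: "(f ^^ i) z \<in> coord_space m" if "z \<in> coord_space m" for i z
    using linear_betweenD(1)[OF linear_funpow[OF f] that] .
  have y: "y \<in> coord_space m" unfolding y_def by (rule pow[OF x])
  have "N + Suc k = Suc m + (N + k - m)" "N + k = m + (N + k - m)" using \<open>m \<le> N\<close> by simp_all
  then have eq: "(f ^^ (N + Suc k)) x = (f ^^ Suc m) y" "(f ^^ (N + k)) x = (f ^^ m) y"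
    by (metis funpow_add o_apply y_def)+
  have zero: "(f ^^ l) y = 0" if "Suc m \<le> l" for l
  proof -
    have "(f ^^ (l - Suc m)) ((f ^^ Suc m) y) = 0"
      using Suc.prems linear_zero[OF linear_funpow[OF f]] by (simp only: eq)
    moreover have "l - Suc m + Suc m = l" using that by simp
    ultimately show ?thesis by (metis funpow_add o_apply)
  qed
  obtain c where c: "\<exists>i<Suc m. c i \<noteq> 0" "(\<Sum>i<Suc m. coord_scale (c i) ((f ^^ i) y)) = 0"
    by (rule coord_dependent[of "Suc m" "\<lambda>i. (f ^^ i) y" m]) (use pow[OF y] in auto)
  obtain a where a: "c a \<noteq> 0" "a \<le> m" and small: "\<And>i. i < a \<Longrightarrow> c i = 0"
    using least_nonzero[OF c(1)] unfolding less_Suc_eq_le by blast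
  have "0 = (f ^^ (m - a)) (\<Sum>i<Suc m. coord_scale (c i) ((f ^^ i) y))"
    using c(2) linear_zero[OF linear_funpow[OF f]] by simp
  also have "\<dots> = (\<Sum>i<Suc m. coord_scale (c i) ((f ^^ (m - a)) ((f ^^ i) y)))"
    by (rule linear_sum[OF linear_funpow[OF f]]) (rule pow[OF y])
  also have "\<dots> = (\<Sum>i<Suc m. coord_scale (c i) ((f ^^ (m - a + i)) y))"
    by (simp add: funpow_add)
  also have "\<dots> = (\<Sum>i\<in>{a}. coord_scale (c i) ((f ^^ (m - a + i)) y))"
    \<comment> \<open>below \<open>a\<close> the coefficients vanish, above \<open>a\<close> the exponent is at least \<open>m + 1\<close>\<close>
  proof (rule sum.mono_neutral_right)
    show "\<forall>i\<in>{..<Suc m} - {a}. coord_scale (c i) ((f ^^ (m - a + i)) y) = 0"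
    proof
      fix i assume i: "i \<in> {..<Suc m} - {a}"
      show "coord_scale (c i) ((f ^^ (m - a + i)) y) = 0"
      proof (cases "i < a")
        case False
        then have "Suc m \<le> m - a + i" using i a(2) by auto
        from zero[OF this] show ?thesis by (simp only: coord.scale_zero_right)
      qed (simp add: small)
    qed
  qed (use a in auto)
  finally have "(f ^^ m) y = 0" using a by simp
  then show ?case using Suc.IH eq(2) by simp
qed simp

section \<open>Endomorphisms of coordinate representations\<close>

lemma coord_rep_simps [simp]:
  "scale1 (coord_rep m n f g) = coord_scale" "scale2 (coord_rep m n f g) = coord_scale"
  "space1 (coord_rep m n f g) = coord_space m" "space2 (coord_rep m n f g) = coord_space n"
  "arrow1 (coord_rep m n f g) = f" "arrow2 (coord_rep m n f g) = g"
  by (simp_all add: coord_rep_def)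

lemma is_rep_coord_rep: "is_rep (coord_rep m n f g) \<longleftrightarrow> coord_linear m n f \<and> coord_linear m n g"
  by (simp add: is_rep_def subspace_coord_space coord.vector_space_axioms)

lemma zero_coord_rep_iff: "zero_rep (coord_rep m n f g) \<longleftrightarrow> m = 0 \<and> n = 0"
  by (simp add: zero_rep_def coord_space_trivial_iff)

lemma fin_dim_coord_rep: "fin_dim_rep (coord_rep m n f g)"
  unfolding fin_dim_rep_def coord_rep_simps
  by (intro conjI exI[of _ "unit_vec ` {..<_}"]) (simp_all add: coord_space_eq_span)

lemma coord_morphism_iff:
  "rep_morphism (coord_rep m n f g) (coord_rep m' n' f' g') p q \<longleftrightarrow>
    coord_linear m m' p \<and> coord_linear n n' q \<and>
    (\<forall>x\<in>coord_space m. f' (p x) = q (f x)) \<and> (\<forall>x\<in>coord_space m. g' (p x) = q (g x))"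
  by (simp add: rep_morphism_def)

lemma coord_morphism_cong:
  assumes "\<And>x. x \<in> coord_space m \<Longrightarrow> f x = h x" "\<And>x. x \<in> coord_space m \<Longrightarrow> g x = k x"
    "\<And>x. x \<in> coord_space m' \<Longrightarrow> f' x = h' x" "\<And>x. x \<in> coord_space m' \<Longrightarrow> g' x = k' x"
  shows "rep_morphism (coord_rep m n f g) (coord_rep m' n' f' g') p q \<longleftrightarrow>
    rep_morphism (coord_rep m n h k) (coord_rep m' n' h' k') p q"
  using assms by (auto simp: coord_morphism_iff linear_betweenD(1))

text \<open>
  Fitting's lemma: a high power of an endomorphism is bijective on its own image, so the image is a
  direct summand. It is not everything if the endomorphism has a kernel, so it is zero if the
  representation is indecomposable.
\<close>

lemma fitting:
  fixes f g :: "(nat \<Rightarrow> 'k::field) \<Rightarrow> nat \<Rightarrow> 'k"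
  assumes X: "indecomposable (coord_rep m n f g)"
    and e: "rep_morphism (coord_rep m n f g) (coord_rep m n f g) e1 e2"
    and x: "x \<in> coord_space m" "x \<noteq> 0" "e1 x = 0"
  shows "\<exists>N. \<forall>x\<in>coord_space m. (e1 ^^ N) x = 0"
proof -
  have fg: "coord_linear m n f" "coord_linear m n g"
    using X by (auto simp: indecomposable_def is_rep_coord_rep)
  have e': "coord_linear m m e1" "coord_linear n n e2"
    "\<And>x. x \<in> coord_space m \<Longrightarrow> f (e1 x) = e2 (f x)" "\<And>x. x \<in> coord_space m \<Longrightarrow> g (e1 x) = e2 (g x)"
    using e by (auto simp: coord_morphism_iff)
  \<comment> \<open>large enough for both spaces, and non-zero so that the power still kills \<open>x\<close>\<close>
  define N where "N = Suc (m + n)"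
  define p where "p = e1 ^^ N"
  define q where "q = e2 ^^ N"
  have lin: "coord_linear m m p" "coord_linear n n q"
    unfolding p_def q_def using e' by (auto intro: linear_funpow)
  have e1_pow: "(e1 ^^ i) x \<in> coord_space m" if "x \<in> coord_space m" for i x
    using linear_betweenD(1)[OF linear_funpow[OF e'(1)] that] .
  have comm: "f (p x) = q (f x)" "g (p x) = q (g x)" if "x \<in> coord_space m" for x
  proof -
    have "f ((e1 ^^ i) x) = (e2 ^^ i) (f x)" for i
      by (induction i) (simp_all add: e'(3) e1_pow[OF that])
    moreover have "g ((e1 ^^ i) x) = (e2 ^^ i) (g x)" for i
      by (induction i) (simp_all add: e'(4) e1_pow[OF that])
    ultimately show "f (p x) = q (f x)" "g (p x) = q (g x)" by (simp_all add: p_def q_def)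
  qed
  have sub: "coord.subspace (h ` coord_space l)" "h ` coord_space l \<subseteq> coord_space l"
    if "coord_linear l l h" for l and h :: "(nat \<Rightarrow> 'k) \<Rightarrow> nat \<Rightarrow> 'k"
  proof -
    note h = linear_betweenD[OF that]
    show "h ` coord_space l \<subseteq> coord_space l" using h(1) by blast
    show "coord.subspace (h ` coord_space l)"
      unfolding coord.subspace_def
    proof (intro conjI ballI allI)
      show "0 \<in> h ` coord_space l" using linear_zero[OF that] by (metis image_eqI coord_space_closed(1))
      fix x assume "x \<in> h ` coord_space l"
      then obtain u where u: "u \<in> coord_space l" "x = h u" by blast
      show "coord_scale c x \<in> h ` coord_space l" for c
        using u h(3) by (intro image_eqI[of _ _ "coord_scale c u"]) auto
      fix y assume "y \<in> h ` coord_space l"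
      then obtain w where w: "w \<in> coord_space l" "y = h w" by blast
      show "x + y \<in> h ` coord_space l"
        using u w h(2) by (intro image_eqI[of _ _ "u + w"]) auto
    qed
  qed
  have bij: "bij_betw (h ^^ N) ((h ^^ N) ` coord_space l) ((h ^^ N) ` coord_space l)"
    if h: "coord_linear l l h" and l: "l \<le> N" for l and h :: "(nat \<Rightarrow> 'k) \<Rightarrow> nat \<Rightarrow> 'k"
  proof (rule injective_self_map_surj)
    note lp = linear_funpow[OF h, of N]
    show "coord.subspace ((h ^^ N) ` coord_space l)" "(h ^^ N) ` coord_space l \<subseteq> coord_space l"
      using sub[OF lp] .
    then show "linear_between coord_scale ((h ^^ N) ` coord_space l) coord_scale ((h ^^ N) ` coord_space l) (h ^^ N)"
      using linear_betweenD[OF lp] by (auto simp: linear_between_def subset_iff)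
    fix y assume "y \<in> (h ^^ N) ` coord_space l" "(h ^^ N) y = 0"
    then obtain x where x: "x \<in> coord_space l" "y = (h ^^ N) x" "(h ^^ (N + N)) x = 0"
      by (auto simp: funpow_add)
    then show "y = 0" using kernel_of_power_stable[OF h x(1) l x(3)] by simp
  qed
  let ?X = "coord_rep m n f g"
  define Y where "Y = ?X\<lparr>space1 := p ` coord_space m, space2 := q ` coord_space n\<rparr>"
  have Y_simps: "scale1 Y = coord_scale" "scale2 Y = coord_scale" "arrow1 Y = f" "arrow2 Y = g"
      "space1 Y = p ` coord_space m" "space2 Y = q ` coord_space n"
    by (simp_all add: Y_def)
  have lin_sub: "linear_between coord_scale (p ` coord_space m) coord_scale (q ` coord_space n) h"
    if h: "coord_linear m n h" "\<And>x. x \<in> coord_space m \<Longrightarrow> h (p x) = q (h x)" for h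
    unfolding linear_between_def
  proof (intro conjI ballI allI)
    show "h x \<in> q ` coord_space n" if "x \<in> p ` coord_space m" for x
      using that h(2) linear_betweenD(1)[OF h(1)] by auto
    fix x y c assume x: "x \<in> p ` coord_space m" and y: "y \<in> p ` coord_space m"
    have xy: "x \<in> coord_space m" "y \<in> coord_space m" using x y sub(2)[OF lin(1)] by blast+
    show "h (x + y) = h x + h y" by (rule linear_betweenD(2)[OF h(1) xy])
    show "h (coord_scale c x) = coord_scale c (h x)" by (rule linear_betweenD(3)[OF h(1) xy(1)])
  qed
  have Y: "is_rep Y"
    unfolding is_rep_def Y_simps
    using coord.vector_space_axioms sub(1)[OF lin(1)] sub(1)[OF lin(2)]
      lin_sub[OF fg(1) comm(1)] lin_sub[OF fg(2) comm(2)] by blast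
  have inc: "rep_morphism Y ?X (\<lambda>x. x) (\<lambda>x. x)"
    using sub(2)[OF lin(1)] sub(2)[OF lin(2)]
    by (auto simp: rep_morphism_def Y_simps linear_between_def)
  have proj: "rep_morphism ?X Y p q"
    using lin comm by (auto simp: rep_morphism_def Y_simps linear_between_def)
  have "zero_rep Y"
  proof (rule ccontr)
    assume nz: "\<not> zero_rep Y"
    have "bij_betw p (space1 ?X) (space1 Y)"
      by (rule indecomposable_retract(1)[OF X Y nz inc proj])
        (use bij[OF e'(1)] bij[OF e'(2)] in \<open>simp_all add: Y_simps p_def q_def N_def del: funpow.simps\<close>)
    then have "inj_on p (coord_space m)" by (simp add: bij_betw_def)
    moreover have "p x = 0"
      using x(3) linear_zero[OF linear_funpow[OF e'(1)]]
      by (simp add: p_def N_def funpow_Suc_right del: funpow.simps)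
    ultimately show False using x linear_zero[OF lin(1)] by (metis coord_space_closed(1) inj_onD)
  qed
  then have "\<forall>x\<in>coord_space m. (e1 ^^ N) x = 0" by (auto simp: zero_rep_def Y_simps p_def)
  then show ?thesis by blast
qed

section \<open>The representations in the list are indecomposable\<close>

text \<open>An idempotent scalar is 0 or 1.\<close>

lemma indecomposable_if_scalar_endomorphisms:
  fixes X :: "('k::field, 'a::ab_group_add, 'b::ab_group_add) kronecker_rep"
  assumes X: "is_rep X" "\<not> zero_rep X"
    and scalar: "\<And>e1 e2. rep_morphism X X e1 e2 \<Longrightarrow>
      \<exists>c. (\<forall>x\<in>space1 X. e1 x = scale1 X c x) \<and> (\<forall>x\<in>space2 X. e2 x = scale2 X c x)"
  shows "indecomposable X"
proof (rule indecomposable_if_no_idempotent[OF X])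
  fix e1 e2
  assume e: "rep_morphism X X e1 e2"
    and idem: "\<forall>x\<in>space1 X. e1 (e1 x) = e1 x" "\<forall>x\<in>space2 X. e2 (e2 x) = e2 x"
  note x = is_repD[OF X(1)]
  interpret s1: vector_space "scale1 X" by (rule x(1))
  interpret s2: vector_space "scale2 X" by (rule x(3))
  obtain c where c: "\<forall>x\<in>space1 X. e1 x = scale1 X c x" "\<forall>x\<in>space2 X. e2 x = scale2 X c x"
    using scalar[OF e] by blast
  have cc1: "c * c - c = 0" if "x \<in> space1 X" "x \<noteq> 0" for x
  proof -
    have "scale1 X (c * c) x = scale1 X c x"
      using idem(1) c(1) that s1.subspace_scale[OF x(2)] by (metis s1.scale_scale)
    then show ?thesis using that(2) by simp
  qed
  have cc2: "c * c - c = 0" if "x \<in> space2 X" "x \<noteq> 0" for x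
  proof -
    have "scale2 X (c * c) x = scale2 X c x"
      using idem(2) c(2) that s2.subspace_scale[OF x(4)] by (metis s2.scale_scale)
    then show ?thesis using that(2) by simp
  qed
  have "(\<exists>x\<in>space1 X. x \<noteq> 0) \<or> (\<exists>x\<in>space2 X. x \<noteq> 0)"
    using X(2) s1.subspace_0[OF x(2)] s2.subspace_0[OF x(4)] unfolding zero_rep_def by blast
  then have "c * c - c = 0" using cc1 cc2 by blast
  then have "c * (c - 1) = 0" by (simp add: algebra_simps)
  then have "c = 0 \<or> c = 1" by simp
  then show "(\<forall>x\<in>space1 X. e1 x = 0) \<and> (\<forall>x\<in>space2 X. e2 x = 0) \<or>
      (\<forall>x\<in>space1 X. e1 x = x) \<and> (\<forall>x\<in>space2 X. e2 x = x)"
    using c by auto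
qed

abbreviation (input) shift_right :: "(nat \<Rightarrow> 'k::field) \<Rightarrow> nat \<Rightarrow> 'k" where
  "shift_right \<equiv> \<lambda>v i. if i = 0 then 0 else v (i - 1)"

lemma is_rep_P_rep: "is_rep (P_rep r)"
  by (auto simp: P_rep_def is_rep_coord_rep linear_between_def coord_space_def fun_eq_iff)

text \<open>
  The second component of an endomorphism commutes with the shift, hence is determined by the image
  of the first unit vector; applying the shift \<open>r\<close> times moves all coordinates of that image but the
  first out of $k^{r+1}$.
\<close>

lemma P_rep_endomorphism_scalar:
  fixes e1 e2 :: "(nat \<Rightarrow> 'k::field) \<Rightarrow> nat \<Rightarrow> 'k"
  assumes "rep_morphism (P_rep r) (P_rep r) e1 e2"
  shows "\<exists>c. (\<forall>x\<in>coord_space r. e1 x = coord_scale c x) \<and> (\<forall>x\<in>coord_space (r + 1). e2 x = coord_scale c x)"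
proof -
  have e: "coord_linear r r e1" "coord_linear (r + 1) (r + 1) e2"
    "\<And>x. x \<in> coord_space r \<Longrightarrow> e1 x = e2 x"
    "\<And>x. x \<in> coord_space r \<Longrightarrow> shift_right (e1 x) = e2 (shift_right x)"
    using assms by (auto simp: P_rep_def coord_morphism_iff)
  define v where "v = e2 (unit_vec 0)"
  have pow: "e2 (unit_vec i) = (\<lambda>j. if j < i then 0 else v (j - i))" if "i \<le> r" for i
    using that
  proof (induction i)
    case (Suc i)
    have *: "(unit_vec i :: nat \<Rightarrow> 'k) \<in> coord_space r" using Suc.prems by simp
    have "(unit_vec (Suc i) :: nat \<Rightarrow> 'k) = shift_right (unit_vec i)" by (auto simp: fun_eq_iff)
    then have "e2 (unit_vec (Suc i)) = e2 (shift_right (unit_vec i))" by (rule arg_cong)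
    also have "\<dots> = shift_right (e2 (unit_vec i))"
      using e(3)[OF *] e(4)[OF *] by (simp only:)
    also have "\<dots> = (\<lambda>j. if j < Suc i then 0 else v (j - Suc i))"
      using Suc by (auto simp: fun_eq_iff)
    finally show ?case .
  qed (simp add: v_def)
  have "e2 (unit_vec r) \<in> coord_space (r + 1)" by (rule linear_betweenD(1)[OF e(2)]) simp
  then have "v l = 0" if "l \<ge> 1" for l
    using that pow[of r] by (auto simp: coord_space_def dest: spec[of _ "r + l"])
  then have unit: "e2 (unit_vec i) = coord_scale (v 0) (unit_vec i)" if "i \<le> r" for i
    using pow[OF that] by (auto simp: fun_eq_iff)
  have "e2 x = coord_scale (v 0) x" if "x \<in> coord_space (r + 1)" for x
  proof (rule linear_eqI[OF e(2) _ unit that])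
    show "coord_linear (r + 1) (r + 1) (coord_scale (v 0))"
      by (simp add: linear_between_def coord.scale_right_distrib mult.commute)
  qed simp
  moreover have "coord_space r \<subseteq> (coord_space (r + 1) :: (nat \<Rightarrow> 'k) set)" by (auto simp: coord_space_def)
  ultimately show ?thesis using e(3) by (intro exI[of _ "v 0"]) auto
qed

lemma indecomposable_P_rep: "indecomposable (P_rep r :: ('k::field, nat \<Rightarrow> 'k, nat \<Rightarrow> 'k) kronecker_rep)"
proof (rule indecomposable_if_scalar_endomorphisms[OF is_rep_P_rep])
  show "\<not> zero_rep (P_rep r)" by (simp add: P_rep_def zero_coord_rep_iff)
  show "\<exists>c. (\<forall>x\<in>space1 (P_rep r). e1 x = scale1 (P_rep r) c x) \<and> (\<forall>x\<in>space2 (P_rep r). e2 x = scale2 (P_rep r) c x)"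
    if "rep_morphism (P_rep r) (P_rep r) e1 e2" for e1 e2 :: "(nat \<Rightarrow> 'k) \<Rightarrow> nat \<Rightarrow> 'k"
    using P_rep_endomorphism_scalar[OF that] by (simp add: P_rep_def)
qed

text \<open>
  Subtracting the eigenvalue turns the Jordan block into the left shift, and enough shifts move the
  last non-zero coordinate of a vector to the front.
\<close>

lemma jordan_invariant_contains_first_unit:
  assumes U: "coord.subspace U" "U \<subseteq> coord_space p"
    and inv: "\<And>x. x \<in> U \<Longrightarrow> jordan_map \<mu> x \<in> U" and x: "x \<in> U" "x \<noteq> 0"
  shows "unit_vec 0 \<in> U"
proof -
  have shift: "(\<lambda>i. y (i + 1)) \<in> U" if "y \<in> U" for y
  proof -
    have "jordan_map \<mu> y - coord_scale \<mu> y \<in> U"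
      using inv[OF that] coord.subspace_scale[OF U(1) that] by (rule coord.subspace_diff[OF U(1)])
    moreover have "jordan_map \<mu> y - coord_scale \<mu> y = (\<lambda>i. y (i + 1))"
      by (auto simp: jordan_map_def fun_eq_iff)
    ultimately show ?thesis by simp
  qed
  have shifts: "(\<lambda>i. x (i + k)) \<in> U" for k
  proof (induction k)
    case (Suc k)
    from shift[OF Suc] show ?case by (simp add: ac_simps)
  qed (simp add: x)
  let ?S = "{i. x i \<noteq> 0}"
  have "?S \<subseteq> {..<p}" using x(1) U(2) by (force simp: coord_space_def not_less[symmetric])
  then have fin: "finite ?S" by (rule finite_subset) simp
  have "?S \<noteq> {}" using x(2) by (auto simp: fun_eq_iff)
  then have k: "x (Max ?S) \<noteq> 0" using Max_in[OF fin] by blast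
  have "x (i + Max ?S) = 0" if "i \<noteq> 0" for i
    using Max_ge[OF fin, of "i + Max ?S"] that by auto
  then have "coord_scale (inverse (x (Max ?S))) (\<lambda>i. x (i + Max ?S)) = unit_vec 0"
    using k by (auto simp: fun_eq_iff)
  then show ?thesis using coord.subspace_scale[OF U(1) shifts] by metis
qed

lemma jordan_map_linear: "coord_linear p p (jordan_map \<mu>)"
  by (auto simp: linear_between_def jordan_map_def coord_space_def fun_eq_iff algebra_simps)

text \<open>
  The image and the kernel of an idempotent meet trivially, so they cannot both contain the first
  unit vector.
\<close>

lemma jordan_idempotent:
  fixes e :: "(nat \<Rightarrow> 'k::field) \<Rightarrow> nat \<Rightarrow> 'k"
  assumes e: "coord_linear p p e"
    and comm: "\<And>x. x \<in> coord_space p \<Longrightarrow> e (jordan_map \<mu> x) = jordan_map \<mu> (e x)"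
    and idem: "\<And>x. x \<in> coord_space p \<Longrightarrow> e (e x) = e x"
  shows "(\<forall>x\<in>coord_space p. e x = 0) \<or> (\<forall>x\<in>coord_space p. e x = x)"
proof (rule ccontr)
  assume "\<not> ?thesis"
  then obtain x y where x: "x \<in> coord_space p" "e x \<noteq> 0" and y: "y \<in> coord_space p" "e y \<noteq> y" by blast
  note e' = linear_betweenD[OF e] and e0 = linear_zero[OF e]
  note J = linear_betweenD(1)[OF jordan_map_linear]
  let ?K = "{x \<in> coord_space p. e x = 0}" and ?I = "{x \<in> coord_space p. e x = x}"
  have "jordan_map \<mu> (0 :: nat \<Rightarrow> 'k) = 0" by (rule linear_zero[OF jordan_map_linear])
  then have K: "unit_vec 0 \<in> ?K"
    using y by (intro jordan_invariant_contains_first_unit[of _ p \<mu> "y - e y"])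
      (auto simp: coord.subspace_def e' e0 comm J linear_diff[OF e] idem)
  have I: "unit_vec 0 \<in> ?I"
    using x by (intro jordan_invariant_contains_first_unit[of _ p \<mu> "e x"])
      (auto simp: coord.subspace_def e' e0 comm J idem)
  have "unit_vec 0 = (0 :: nat \<Rightarrow> 'k)" using K I by simp
  from fun_cong[OF this, of 0] show False by simp
qed

lemma indecomposable_jordan:
  assumes "p \<ge> 1"
  shows "indecomposable (coord_rep p p (jordan_map \<mu>) (\<lambda>v. v))"
    and "indecomposable (coord_rep p p (\<lambda>v. v) (jordan_map \<mu>))"
proof -
  have "(\<forall>x\<in>coord_space p. e1 x = 0) \<and> (\<forall>x\<in>coord_space p. e2 x = 0) \<or>
      (\<forall>x\<in>coord_space p. e1 x = x) \<and> (\<forall>x\<in>coord_space p. e2 x = x)"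
    if "coord_linear p p e1" "\<forall>x\<in>coord_space p. e1 x = e2 x"
      "\<forall>x\<in>coord_space p. jordan_map \<mu> (e1 x) = e2 (jordan_map \<mu> x)"
      "\<forall>x\<in>coord_space p. e1 (e1 x) = e1 x"
    for e1 e2
  proof -
    have "e1 (jordan_map \<mu> x) = jordan_map \<mu> (e1 x)" if x: "x \<in> coord_space p" for x
      using \<open>\<forall>x\<in>coord_space p. e1 x = e2 x\<close> linear_betweenD(1)[OF jordan_map_linear x]
        \<open>\<forall>x\<in>coord_space p. jordan_map \<mu> (e1 x) = e2 (jordan_map \<mu> x)\<close> x by metis
    then have "(\<forall>x\<in>coord_space p. e1 x = 0) \<or> (\<forall>x\<in>coord_space p. e1 x = x)"
      using jordan_idempotent[OF that(1)] that(4) by blast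
    then show ?thesis using that(2) by auto
  qed
  note idem = this
  have rep: "is_rep (coord_rep p p (jordan_map \<mu>) (\<lambda>v. v))" "is_rep (coord_rep p p (\<lambda>v. v) (jordan_map \<mu>))"
    by (simp_all add: is_rep_coord_rep jordan_map_linear linear_between_ident)
  have nz: "\<not> zero_rep (coord_rep p p f g)" for f g using assms by (simp add: zero_coord_rep_iff)
  show "indecomposable (coord_rep p p (jordan_map \<mu>) (\<lambda>v. v))"
    by (rule indecomposable_if_no_idempotent[OF rep(1) nz], unfold coord_rep_simps coord_morphism_iff, rule idem)
      auto
  show "indecomposable (coord_rep p p (\<lambda>v. v) (jordan_map \<mu>))"
    by (rule indecomposable_if_no_idempotent[OF rep(2) nz], unfold coord_rep_simps coord_morphism_iff, rule idem)
      auto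
qed

section \<open>Transposition\<close>

text \<open>
  Transposing both arrows exchanges the two spaces, reverses morphisms, and sends $P_r$ to $I_r$.
  This transfers the description of the endomorphisms from $P_r$ to $I_r$, and the construction of
  retracts from $I_r$ to $P_r$.
\<close>

definition dot :: "nat \<Rightarrow> (nat \<Rightarrow> 'k::field) \<Rightarrow> (nat \<Rightarrow> 'k) \<Rightarrow> 'k" where
  "dot n x y = (\<Sum>j<n. x j * y j)"

text \<open>
  The linear map with the transposed matrix. The entries are read off from the values of \<open>f\<close> at the
  unit vectors, so the transpose is linear even for an \<open>f\<close> that is not.
\<close>

definition transposed :: "nat \<Rightarrow> nat \<Rightarrow> ((nat \<Rightarrow> 'k::field) \<Rightarrow> nat \<Rightarrow> 'k) \<Rightarrow> (nat \<Rightarrow> 'k) \<Rightarrow> nat \<Rightarrow> 'k" where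
  "transposed m n f y = (\<lambda>i. if i < m then dot n (f (unit_vec i)) y else 0)"

lemma dot_commute: "dot n x y = dot n y x"
  by (simp add: dot_def mult.commute)

lemma dot_unit_vec: "i < n \<Longrightarrow> dot n (unit_vec i) y = y i"
  by (simp add: dot_def if_distrib[of "\<lambda>u. u * _"] cong: if_cong)

lemma transposed_linear: "coord_linear n m (transposed m n f)"
  by (auto simp: linear_between_def transposed_def dot_def coord_space_def fun_eq_iff
      algebra_simps sum.distrib sum_distrib_left)

lemma transposed_in_coord_space: "transposed m n f y \<in> coord_space m"
  by (simp add: transposed_def coord_space_def)

lemma transposed_adjoint:
  assumes f: "coord_linear m n f" and x: "x \<in> coord_space m"
  shows "dot n (f x) y = dot m x (transposed m n f y)"
proof -
  have "f x = (\<Sum>i<m. coord_scale (x i) (f (unit_vec i)))"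
    by (subst coord_expand[OF x], rule linear_sum[OF f]) simp
  then have "dot n (f x) y = (\<Sum>j<n. \<Sum>i<m. x i * (f (unit_vec i) j * y j))"
    by (simp add: dot_def sum_fun_at sum_distrib_right mult.assoc)
  also have "\<dots> = (\<Sum>i<m. x i * transposed m n f y i)"
    by (subst sum.swap) (simp add: transposed_def dot_def sum_distrib_left)
  finally show ?thesis by (simp add: dot_def)
qed

lemma transposed_unique:
  assumes f: "coord_linear m n f" and z: "z \<in> coord_space m"
    and adj: "\<And>x. x \<in> coord_space m \<Longrightarrow> dot n (f x) y = dot m x z"
  shows "transposed m n f y = z"
proof
  fix i
  show "transposed m n f y i = z i"
  proof (cases "i < m")
    case True
    then have "dot n (f (unit_vec i)) y = z i" by (simp add: adj dot_unit_vec)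
    then show ?thesis using True by (simp add: transposed_def)
  qed (use z in \<open>simp add: transposed_def coord_space_def\<close>)
qed

lemma transposed_cong: "(\<And>x. x \<in> coord_space m \<Longrightarrow> f x = g x) \<Longrightarrow> transposed m n f = transposed m n g"
  by (intro ext) (simp add: transposed_def)

lemma transposed_compose:
  assumes f: "coord_linear m n f" and g: "coord_linear n p g"
  shows "transposed m p (\<lambda>x. g (f x)) z = transposed m n f (transposed n p g z)"
  by (rule transposed_unique[OF linear_between_compose[OF f g]])
    (simp_all add: transposed_in_coord_space linear_betweenD(1)[OF f]
      transposed_adjoint[OF f, symmetric] transposed_adjoint[OF g, symmetric])

lemma transposed_transposed:
  assumes f: "coord_linear m n f" and x: "x \<in> coord_space m"
  shows "transposed n m (transposed m n f) x = f x"
  by (rule transposed_unique[OF transposed_linear linear_betweenD(1)[OF f x]])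
    (simp add: dot_commute[of m] dot_commute[of n] transposed_adjoint[OF f x, symmetric])

lemma transposed_scale: "y \<in> coord_space m \<Longrightarrow> transposed m m (coord_scale c) y = coord_scale c y"
  by (auto simp: transposed_def dot_def coord_space_def fun_eq_iff if_distrib[of "\<lambda>u. u * _"]
      if_distrib[of "\<lambda>u. _ * u"] cong: if_cong)

lemma transposed_ident: "y \<in> coord_space m \<Longrightarrow> transposed m m (\<lambda>x. x) y = y"
  by (auto simp: transposed_def dot_unit_vec coord_space_def fun_eq_iff)

lemma coord_morphism_transposed:
  assumes X: "coord_linear m n f" "coord_linear m n g" and Y: "coord_linear m' n' f'" "coord_linear m' n' g'"
    and pq: "rep_morphism (coord_rep m n f g) (coord_rep m' n' f' g') p q"
  shows "rep_morphism (coord_rep n' m' (transposed m' n' f') (transposed m' n' g'))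
    (coord_rep n m (transposed m n f) (transposed m n g)) (transposed n n' q) (transposed m m' p)"
proof -
  have p: "coord_linear m m' p" and q: "coord_linear n n' q"
    using pq by (auto simp: coord_morphism_iff)
  have "transposed m n h (transposed n n' q y) = transposed m m' p (transposed m' n' h' y)"
    if h: "coord_linear m n h" and h': "coord_linear m' n' h'"
      and eq: "\<forall>x\<in>coord_space m. h' (p x) = q (h x)" for h h' y
    using transposed_compose[OF h q, of y] transposed_compose[OF p h', of y]
      transposed_cong[of m "\<lambda>x. h' (p x)" "\<lambda>x. q (h x)" n'] eq by simp
  then show ?thesis using pq X Y by (simp add: coord_morphism_iff transposed_linear)
qed

lemma transposed_P_rep_arrows:
  fixes y :: "nat \<Rightarrow> 'k::field"
  shows "transposed r (r + 1) (\<lambda>v. v) y = (\<lambda>i. if i < r then y i else 0)"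
  "y \<in> coord_space (r + 1) \<Longrightarrow> transposed r (r + 1) shift_right y = (\<lambda>i. y (i + 1))"
proof -
  show "transposed r (r + 1) (\<lambda>v. v) y = (\<lambda>i. if i < r then y i else 0)"
    by (auto simp: transposed_def dot_unit_vec fun_eq_iff)
  have *: "shift_right (unit_vec i) = (unit_vec (i + 1) :: nat \<Rightarrow> 'k)" for i
    by (auto simp: fun_eq_iff)
  show "transposed r (r + 1) shift_right y = (\<lambda>i. y (i + 1))" if "y \<in> coord_space (r + 1)"
    using that by (auto simp: transposed_def * dot_unit_vec fun_eq_iff coord_space_def)
qed

lemma P_rep_linear:
  "coord_linear r (r + 1) (\<lambda>v. v)" "coord_linear r (r + 1) shift_right"
  by (auto simp: linear_between_def coord_space_def fun_eq_iff)

lemma I_rep_linear: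
  "coord_linear (r + 1) r (\<lambda>v i. if i < r then v i else 0)"
  "coord_linear (r + 1) r (\<lambda>v i. v (i + 1))"
  by (auto simp: linear_between_def coord_space_def fun_eq_iff)

lemma is_rep_I_rep: "is_rep (I_rep r)"
  by (simp only: I_rep_def is_rep_coord_rep I_rep_linear)

lemma transposed_I_rep_arrows:
  fixes y :: "nat \<Rightarrow> 'k::field"
  assumes "y \<in> coord_space r"
  shows "transposed (r + 1) r (\<lambda>v i. if i < r then v i else 0) y = y"
    "transposed (r + 1) r (\<lambda>v i. v (i + 1)) y = shift_right y"
proof -
  have "transposed (r + 1) r (\<lambda>v i. if i < r then v i else 0) y =
      transposed (r + 1) r (transposed r (r + 1) (\<lambda>v. v)) y"
    by (rule fun_cong[OF transposed_cong]) (rule transposed_P_rep_arrows(1)[symmetric])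
  then show "transposed (r + 1) r (\<lambda>v i. if i < r then v i else 0) y = y"
    by (simp only: transposed_transposed[OF P_rep_linear(1) assms])
  have "transposed (r + 1) r (\<lambda>v i. v (i + 1)) y = transposed (r + 1) r (transposed r (r + 1) shift_right) y"
    by (rule fun_cong[OF transposed_cong]) (rule transposed_P_rep_arrows(2)[symmetric])
  then show "transposed (r + 1) r (\<lambda>v i. v (i + 1)) y = shift_right y"
    by (simp only: transposed_transposed[OF P_rep_linear(2) assms])
qed

lemma morphism_into_I_rep_transposed:
  assumes X: "coord_linear m n f" "coord_linear m n g"
    and pq: "rep_morphism (coord_rep m n f g) (I_rep r) p q"
  shows "rep_morphism (P_rep r) (coord_rep n m (transposed m n f) (transposed m n g)) (transposed n r q) (transposed m (r + 1) p)"
  using coord_morphism_transposed[OF X I_rep_linear pq[unfolded I_rep_def]] transposed_I_rep_arrows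
  unfolding P_rep_def by (subst (asm) coord_morphism_cong) auto

lemma morphism_from_I_rep_transposed:
  assumes X: "coord_linear m n f" "coord_linear m n g"
    and pq: "rep_morphism (I_rep r) (coord_rep m n f g) p q"
  shows "rep_morphism (coord_rep n m (transposed m n f) (transposed m n g)) (P_rep r) (transposed r n q) (transposed (r + 1) m p)"
  using coord_morphism_transposed[OF I_rep_linear X pq[unfolded I_rep_def]] transposed_I_rep_arrows
  unfolding P_rep_def by (subst (asm) coord_morphism_cong) auto

text \<open>The transpose of an endomorphism of $I_r$ is an endomorphism of $P_r$, hence a scalar.\<close>

lemma I_rep_endomorphism_scalar:
  fixes e1 e2 :: "(nat \<Rightarrow> 'k::field) \<Rightarrow> nat \<Rightarrow> 'k"
  assumes e: "rep_morphism (I_rep r) (I_rep r) e1 e2"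
  shows "\<exists>c. (\<forall>x\<in>coord_space (r + 1). e1 x = coord_scale c x) \<and> (\<forall>x\<in>coord_space r. e2 x = coord_scale c x)"
proof -
  have lin: "coord_linear (r + 1) (r + 1) e1" "coord_linear r r e2"
    using e by (simp_all add: I_rep_def coord_morphism_iff)
  have "rep_morphism (P_rep r :: ('k, nat \<Rightarrow> 'k, nat \<Rightarrow> 'k) kronecker_rep) (P_rep r)
      (transposed r r e2) (transposed (r + 1) (r + 1) e1)"
    using coord_morphism_transposed[OF I_rep_linear I_rep_linear e[unfolded I_rep_def]] transposed_I_rep_arrows
    unfolding P_rep_def by (subst (asm) coord_morphism_cong) auto
  then obtain c where c: "\<And>x. x \<in> coord_space r \<Longrightarrow> transposed r r e2 x = coord_scale c x"
      "\<And>x. x \<in> coord_space (r + 1) \<Longrightarrow> transposed (r + 1) (r + 1) e1 x = coord_scale c x"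
    using P_rep_endomorphism_scalar by blast
  have "e x = coord_scale c x"
    if "coord_linear l l e" "\<And>x. x \<in> coord_space l \<Longrightarrow> transposed l l e x = coord_scale c x" "x \<in> coord_space l"
    for e l x
    using transposed_transposed[OF that(1,3)] transposed_cong[of l "transposed l l e" "coord_scale c" l] that(2,3)
      transposed_scale[OF that(3)] by metis
  then show ?thesis using lin c by blast
qed

lemma indecomposable_I_rep: "indecomposable (I_rep r :: ('k::field, nat \<Rightarrow> 'k, nat \<Rightarrow> 'k) kronecker_rep)"
proof (rule indecomposable_if_scalar_endomorphisms[OF is_rep_I_rep])
  show "\<not> zero_rep (I_rep r)" by (simp add: I_rep_def zero_coord_rep_iff)
  show "\<exists>c. (\<forall>x\<in>space1 (I_rep r). e1 x = scale1 (I_rep r) c x) \<and> (\<forall>x\<in>space2 (I_rep r). e2 x = scale2 (I_rep r) c x)"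
    if "rep_morphism (I_rep r) (I_rep r) e1 e2" for e1 e2 :: "(nat \<Rightarrow> 'k) \<Rightarrow> nat \<Rightarrow> 'k"
    using I_rep_endomorphism_scalar[OF that] by (simp add: I_rep_def)
qed

section \<open>Splitting off a singular summand\<close>

text \<open>
  The coefficients of a polynomial $v_0 + v_1 z + \dots + v_r z^r$ in the kernel of $z A - B$. Such
  polynomials are the morphisms from $I_r$. Continuing the sequence by zero makes the condition
  $A v_r = 0$ an instance of the general step.
\<close>

definition pencil_chain ::
  "nat \<Rightarrow> ((nat \<Rightarrow> 'k::field) \<Rightarrow> nat \<Rightarrow> 'k) \<Rightarrow> ((nat \<Rightarrow> 'k) \<Rightarrow> nat \<Rightarrow> 'k) \<Rightarrow> nat \<Rightarrow> (nat \<Rightarrow> nat \<Rightarrow> 'k) \<Rightarrow> bool" where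
  "pencil_chain m A B r v \<longleftrightarrow> (\<forall>i. v i \<in> coord_space m) \<and> B (v 0) = 0 \<and>
     (\<forall>i. A (v i) = B (v (Suc i))) \<and> (\<forall>i>r. v i = 0)"

text \<open>
  The hypothesis says that $\sum_i p(\mu_i) x_i = 0$ for all polynomials $p$ of degree less than \<open>N\<close>;
  take for $p$ the product of the $z - \mu_l$ with $l \neq i$.
\<close>

lemma vandermonde_kernel_trivial:
  fixes \<mu> x :: "nat \<Rightarrow> 'k::field"
  assumes inj: "inj_on \<mu> {..<N}" and zero: "\<And>j. j < N \<Longrightarrow> (\<Sum>i<N. \<mu> i ^ j * x i) = 0" and i: "i < N"
  shows "x i = 0"
proof -
  define p where "p = (\<Prod>l\<in>{..<N} - {i}. [:- \<mu> l, 1:])"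
  have deg: "degree p < N"
  proof -
    have "degree p \<le> (\<Sum>l\<in>{..<N} - {i}. degree [:- \<mu> l, 1:])" 
      unfolding p_def by (rule order_trans[OF degree_prod_sum_le]) simp_all
    also have "\<dots> = N - 1" using i by simp
    finally show ?thesis using i by simp
  qed
  have poly_p: "poly p a = (\<Sum>j<N. coeff p j * a ^ j)" for a
    unfolding poly_altdef using deg
    by (intro sum.mono_neutral_left) (auto simp: coeff_eq_0 not_le)
  have "(\<Sum>l<N. poly p (\<mu> l) * x l) = (\<Sum>l<N. \<Sum>j<N. coeff p j * (\<mu> l ^ j * x l))"
    by (simp add: poly_p sum_distrib_right mult.assoc)
  also have "\<dots> = (\<Sum>j<N. coeff p j * (\<Sum>l<N. \<mu> l ^ j * x l))"
    by (subst sum.swap) (simp add: sum_distrib_left)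
  also have "\<dots> = 0" by (simp add: zero)
  finally have "(\<Sum>l<N. poly p (\<mu> l) * x l) = 0" .
  moreover have "poly p (\<mu> l) = 0" if "l < N" "l \<noteq> i" for l
    using that by (auto simp: p_def poly_prod)
  then have "(\<Sum>l<N. poly p (\<mu> l) * x l) = (\<Sum>l\<in>{i}. poly p (\<mu> l) * x l)"
    using i by (intro sum.mono_neutral_right) auto
  moreover have "poly p (\<mu> i) \<noteq> 0"
    using inj i by (auto simp: p_def poly_prod inj_on_def)
  ultimately show ?thesis by simp
qed

text \<open>
  Given vectors $u_i$ with $A u_i = \mu_i B u_i$, every sequence $w_j = \sum_i c_i \mu_i^j u_i$ satisfies
  $A w_j = B w_{j+1}$. Prescribing $w_0 = 0$ and $w_{2m} = 0$ amounts to $2m$ linear conditions on the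
  $c_i$, so $2m + 1$ distinct $\mu_i$ leave a non-trivial solution; cutting it off at $w_{2m}$ gives a
  chain. The chain is not zero because the $\mu_i^j$ with $j \le 2m$ form an invertible Vandermonde
  matrix.
\<close>

lemma singular_pencil_has_chain:
  fixes A B :: "(nat \<Rightarrow> 'k::field) \<Rightarrow> nat \<Rightarrow> 'k"
  assumes inf: "infinite (UNIV :: 'k set)" and A: "coord_linear m n A" and B: "coord_linear m n B"
    and sing: "\<And>\<mu>. \<exists>u\<in>coord_space m. u \<noteq> 0 \<and> A u = coord_scale \<mu> (B u)"
  shows "\<exists>r v. pencil_chain m A B r v \<and> (\<exists>i. v i \<noteq> 0)"
proof -
  obtain \<mu> :: "nat \<Rightarrow> 'k" where \<mu>: "inj \<mu>" using infinite_countable_subset[OF inf] by blast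
  obtain u' where u': "\<And>a. u' a \<in> coord_space m" "\<And>a. u' a \<noteq> 0" "\<And>a. A (u' a) = coord_scale a (B (u' a))"
    using sing by metis
  define u where "u i = u' (\<mu> i)" for i
  have u: "u i \<in> coord_space m" "u i \<noteq> 0" "A (u i) = coord_scale (\<mu> i) (B (u i))" for i
    by (simp_all add: u_def u' del: coord_scale_apply)
  define N where "N = Suc (2 * m)"
  \<comment> \<open>both conditions in one vector: \<open>z i\<close> stacks \<open>u i\<close> on top of \<open>\<mu> i ^ (2 * m)\<close> times \<open>u i\<close>\<close>
  define z where "z i = (\<lambda>j. if j < m then u i j else \<mu> i ^ (2 * m) * u i (j - m))" for i
  have z: "z i \<in> coord_space (2 * m)" for i
    using u(1)[of i] by (auto simp: z_def coord_space_def)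
  obtain c where c: "\<exists>i<N. c i \<noteq> 0" "(\<Sum>i<N. coord_scale (c i) (z i)) = 0"
    by (rule coord_dependent[of N z "2 * m", OF z]) (simp_all add: N_def)
  define w where "w j = (\<Sum>i<N. coord_scale (c i * \<mu> i ^ j) (u i))" for j
  have w: "w j \<in> coord_space m" for j
    unfolding w_def by (intro coord_space_sum coord_space_closed u)
  have w_at: "w j t = (\<Sum>i<N. \<mu> i ^ j * (c i * u i t))" for j t
    by (simp add: w_def sum_fun_at ac_simps)
  have z_at: "(\<Sum>i<N. c i * z i t) = 0" for t
    using fun_cong[OF c(2), of t] by (simp add: sum_fun_at)
  have w0: "w 0 = 0"
  proof
    fix t show "w 0 t = 0 t"
      using z_at[of t] w[of 0] by (cases "t < m") (simp_all add: w_at z_def coord_space_def)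
  qed
  have wend: "w (2 * m) = 0"
  proof
    fix t show "w (2 * m) t = 0 t"
      using z_at[of "t + m"] by (simp add: w_at z_def ac_simps)
  qed
  have step: "A (w j) = B (w (Suc j))" for j
  proof -
    have "A (w j) = (\<Sum>i<N. coord_scale (c i * \<mu> i ^ j) (A (u i)))"
      unfolding w_def by (rule linear_sum[OF A]) (rule u)
    also have "\<dots> = (\<Sum>i<N. coord_scale (c i * \<mu> i ^ Suc j) (B (u i)))"
      by (simp add: u(3) ac_simps del: coord_scale_apply)
    also have "\<dots> = B (w (Suc j))"
      unfolding w_def by (rule linear_sum[OF B, symmetric]) (rule u)
    finally show ?thesis .
  qed
  define v where "v j = (if j < 2 * m then w j else 0)" for j
  have v0: "v 0 = 0" by (simp add: v_def w0)
  have "A (v i) = B (v (Suc i))" for i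
  proof -
    consider "Suc i < 2 * m" | "Suc i = 2 * m" | "2 * m \<le> i" by linarith
    then show ?thesis
    proof cases
      case 2
      then show ?thesis using step[of i] wend by (simp add: v_def)
    qed (simp_all add: v_def step linear_zero[OF A] linear_zero[OF B])
  qed
  then have "pencil_chain m A B (2 * m) v"
    unfolding pencil_chain_def using w v0 linear_zero[OF B] by (auto simp: v_def)
  moreover have "\<exists>i. v i \<noteq> 0"
  proof (rule ccontr)
    assume "\<not> (\<exists>i. v i \<noteq> 0)"
    then have "w j = 0" if "j < N" for j
      using that wend unfolding v_def N_def by (metis less_Suc_eq)
    then have "(\<Sum>i<N. \<mu> i ^ j * (c i * u i t)) = 0" if "j < N" for j t
      using that by (simp add: w_at[symmetric])
    then have "c i * u i t = 0" if "i < N" for i t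
      using vandermonde_kernel_trivial[OF inj_on_subset[OF \<mu> subset_UNIV], of N "\<lambda>i. c i * u i t" i] that by blast
    then have "u i = 0" if "i < N" "c i \<noteq> 0" for i
      using that by (auto simp: fun_eq_iff)
    then show False using c(1) u(2) by blast
  qed
  ultimately show ?thesis by blast
qed

lemma separating_functional:
  fixes s :: "'k::field \<Rightarrow> 'v::ab_group_add \<Rightarrow> 'v"
  assumes "vector_space s" "module.subspace s S" "x \<notin> S"
  obtains H where "\<And>y z. H (y + z) = H y + H z" "\<And>c y. H (s c y) = c * H y"
    "\<And>y. y \<in> S \<Longrightarrow> H y = 0" "H x = 1"
proof -
  interpret vector_space s by fact
  interpret k: vector_space "(*) :: 'k \<Rightarrow> 'k \<Rightarrow> 'k" by unfold_locales (simp_all add: algebra_simps)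
  interpret vector_space_pair s "(*) :: 'k \<Rightarrow> 'k \<Rightarrow> 'k" ..
  obtain Bs where Bs: "Bs \<subseteq> S" "independent Bs" "S \<subseteq> span Bs"
    by (rule maximal_independent_subset)
  have "span Bs = S" using Bs assms(2) by (metis span_minimal subset_antisym)
  then have ind: "independent (insert x Bs)" using Bs assms(3) by (simp add: independent_insertI)
  obtain H where H: "Vector_Spaces.linear s (*) H" "\<forall>y\<in>insert x Bs. H y = (if y = x then 1 else 0)"
    using linear_independent_extend[OF ind, of "\<lambda>y. if y = x then 1 else 0"] by blast
  interpret H: Vector_Spaces.linear s "(*)" H by fact
  show ?thesis
  proof (rule that[of H])
    show "H y = 0" if "y \<in> S" for y
    proof (rule H.eq_0_on_span[where b = Bs])
      show "y \<in> span Bs" using that Bs by blast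
      show "H b = 0" if "b \<in> Bs" for b using that H(2) Bs(1) assms(3) by auto
    qed
  qed (use H(2) H.add H.scale in auto)
qed

lemma shortest_chain:
  assumes "pencil_chain m A B r0 v0" "v0 i0 \<noteq> 0"
  obtains r v where "pencil_chain m A B r v" "v r \<noteq> 0"
    "\<And>s u i. s < r \<Longrightarrow> pencil_chain m A B s u \<Longrightarrow> u i = 0"
proof -
  let ?P = "\<lambda>r. \<exists>v. pencil_chain m A B r v \<and> (\<exists>i. v i \<noteq> 0)"
  have "?P r0" using assms by blast
  then obtain r where r: "?P r" and least: "\<And>s. s < r \<Longrightarrow> \<not> ?P s"
    using exists_least_iff[of ?P] by auto
  obtain v where v: "pencil_chain m A B r v" "\<exists>i. v i \<noteq> 0" using r by blast
  have "v r \<noteq> 0"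
  proof
    assume vr: "v r = 0"
    show False
    proof (cases r)
      case 0
      then have "v i = 0" for i using v(1) vr by (cases i) (auto simp: pencil_chain_def)
      then show False using v(2) by blast
    next
      case (Suc s)
      have "v i = 0" if "s < i" for i
        using that Suc v(1) vr unfolding pencil_chain_def by (cases "i = r") auto
      then have "pencil_chain m A B s v" using v(1) unfolding pencil_chain_def by blast
      then show False using least[of s] v(2) Suc by blast
    qed
  qed
  then show ?thesis using that v(1) least by blast
qed

lemma combination_linear:
  assumes u: "\<And>i. u i \<in> coord_space l'"
  shows "coord_linear l l' (\<lambda>x. \<Sum>i<k. coord_scale (x i) (u i))"
  unfolding linear_between_def
proof (intro conjI ballI allI)
  fix x y :: "nat \<Rightarrow> 'a" and c
  show "(\<Sum>i<k. coord_scale (x i) (u i)) \<in> coord_space l'"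
    by (intro coord_space_sum coord_space_closed u)
  show "(\<Sum>i<k. coord_scale ((x + y) i) (u i)) = (\<Sum>i<k. coord_scale (x i) (u i)) + (\<Sum>i<k. coord_scale (y i) (u i))"
    by (simp only: plus_fun_apply coord.scale_left_distrib sum.distrib)
  show "(\<Sum>i<k. coord_scale (coord_scale c x i) (u i)) = coord_scale c (\<Sum>i<k. coord_scale (x i) (u i))"
    by (simp only: coord.scale_sum_right coord_scale_apply coord.scale_scale)
qed

text \<open>
  The morphism sends the \<open>i\<close>-th unit vector to \<open>v i\<close> in the first space and to \<open>A (v i)\<close>, which is
  \<open>B (v (Suc i))\<close>, in the second.
\<close>

lemma chain_morphism:
  assumes A: "coord_linear m n A" and B: "coord_linear m n B" and v: "pencil_chain m A B r v"
  shows "rep_morphism (I_rep r) (coord_rep m n A B)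
    (\<lambda>x. \<Sum>i<r + 1. coord_scale (x i) (v i)) (\<lambda>y. \<Sum>i<r. coord_scale (y i) (A (v i)))"
proof -
  have v': "v i \<in> coord_space m" "B (v 0) = 0" "A (v i) = B (v (Suc i))" "i > r \<Longrightarrow> v i = 0" for i
    using v by (auto simp: pencil_chain_def)
  have Av: "A (v i) \<in> coord_space n" for i using linear_betweenD(1)[OF A v'(1)] .
  have A_last: "A (v r) = 0" using v'(3)[of r] v'(4)[of "Suc r"] linear_zero[OF B] by simp
  show ?thesis
    unfolding I_rep_def coord_morphism_iff
  proof (intro conjI ballI)
    fix x :: "nat \<Rightarrow> 'a"
    have "A (\<Sum>i<r + 1. coord_scale (x i) (v i)) = (\<Sum>i<r + 1. coord_scale (x i) (A (v i)))"
      by (rule linear_sum[OF A]) (rule v')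
    also have "\<dots> = (\<Sum>i<r. coord_scale (x i) (A (v i)))" by (simp add: A_last)
    also have "\<dots> = (\<Sum>i<r. coord_scale (if i < r then x i else 0) (A (v i)))" by simp
    finally show "A (\<Sum>i<r + 1. coord_scale (x i) (v i)) =
        (\<Sum>i<r. coord_scale (if i < r then x i else 0) (A (v i)))" .
    have "B (\<Sum>i<r + 1. coord_scale (x i) (v i)) = (\<Sum>i<r + 1. coord_scale (x i) (B (v i)))"
      by (rule linear_sum[OF B]) (rule v')
    also have "\<dots> = (\<Sum>i<r. coord_scale (x (i + 1)) (A (v i)))"
      unfolding Suc_eq_plus1[symmetric] sum.lessThan_Suc_shift by (simp add: v'(2,3))
    finally show "B (\<Sum>i<r + 1. coord_scale (x i) (v i)) = (\<Sum>i<r. coord_scale (x (i + 1)) (A (v i)))" .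
  qed (intro combination_linear v' Av)+
qed

text \<open>
  For \<open>r > 0\<close>, a morphism to $I_r$ is a family of functionals $h_0, \dots, h_{r-1}$ on the second space
  with $h_{i+1} A = h_i B$, that is, one functional on sequences that vanishes on all
  $(B x_0, B x_1 - A x_0, B x_2 - A x_1, \dots)$ with $x_i = 0$ for $i \ge r - 1$. Its value at
  $(A v_0, 0, 0, \dots) = (B v_1, 0, 0, \dots)$ can be made non-zero unless this is itself such a
  sequence. But then the $x_i - v_{i+1}$ form a chain of degree at most \<open>r - 1\<close>, which must be zero by
  minimality of \<open>r\<close>, although its last member is $- v_r$. For \<open>r = 0\<close>, any functional that is not
  zero at $v_0$ will do.
\<close>

lemma chain_functional:
  fixes A B :: "(nat \<Rightarrow> 'k::field) \<Rightarrow> nat \<Rightarrow> 'k"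
  assumes A: "coord_linear m n A" and B: "coord_linear m n B"
    and v: "pencil_chain m A B r v" "v r \<noteq> 0"
    and short: "\<And>s u i. s < r \<Longrightarrow> pencil_chain m A B s u \<Longrightarrow> u i = 0"
  obtains g1 g2 where "rep_morphism (coord_rep m n A B) (I_rep r) g1 g2" "g1 (v 0) 0 \<noteq> 0"
proof (cases r)
  case 0
  have "v 0 \<notin> {0}" using v(2) 0 by simp
  then obtain H where H: "\<And>y z. H (y + z) = H y + H z" "\<And>c y. H (coord_scale c y) = c * H y" "H (v 0) = 1"
    using separating_functional[OF coord.vector_space_axioms coord.subspace_single_0] by metis
  show ?thesis
    by (rule that[of "\<lambda>x i. if i = 0 then H x else 0" "\<lambda>x. 0"])
      (use H 0 in \<open>auto simp: I_rep_def coord_morphism_iff linear_between_def coord_space_def fun_eq_iff\<close>)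
next
  case (Suc s)
  have v': "v i \<in> coord_space m" "B (v 0) = 0" "A (v i) = B (v (Suc i))" "i > r \<Longrightarrow> v i = 0" for i
    using v(1) by (auto simp: pencil_chain_def)
  \<comment> \<open>sequences of vectors with pointwise operations\<close>
  define sc :: "'k \<Rightarrow> (nat \<Rightarrow> nat \<Rightarrow> 'k) \<Rightarrow> nat \<Rightarrow> nat \<Rightarrow> 'k" where "sc c x = (\<lambda>i. coord_scale c (x i))" for c x
  interpret sc: vector_space sc
    by unfold_locales (auto simp: sc_def fun_eq_iff algebra_simps)
  define D where "D x = (\<lambda>i. B (x i) - (if i = 0 then 0 else A (x (i - 1))))" for x :: "nat \<Rightarrow> nat \<Rightarrow> 'k"
  define S where "S = D ` {x. (\<forall>i. x i \<in> coord_space m) \<and> (\<forall>i\<ge>s. x i = 0)}"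
  define t where "t = (\<lambda>i::nat. if i = 0 then B (v (Suc 0)) else 0)"
  have S: "sc.subspace S"
  proof -
    have D_add: "D x + D y = D (x + y)" if "\<forall>i. x i \<in> coord_space m" "\<forall>i. y i \<in> coord_space m" for x y
      using that by (auto simp: D_def fun_eq_iff linear_betweenD(2)[OF A] linear_betweenD(2)[OF B])
    have D_sc: "sc c (D x) = D (sc c x)" if "\<forall>i. x i \<in> coord_space m" for x c
      using that by (simp add: D_def sc_def fun_eq_iff linear_betweenD(3)[OF A] linear_betweenD(3)[OF B]
          coord.scale_right_diff_distrib)
    have "D 0 = 0" by (auto simp: D_def fun_eq_iff zero_fun_def linear_zero[OF A, unfolded zero_fun_def] linear_zero[OF B, unfolded zero_fun_def])
    then have D0: "0 \<in> S" unfolding S_def by (intro image_eqI[of _ _ 0]) auto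
    show ?thesis
      unfolding sc.subspace_def
    proof (intro conjI ballI allI D0)
      fix y assume "y \<in> S"
      then obtain a where a: "\<forall>i. a i \<in> coord_space m" "\<forall>i\<ge>s. a i = 0" "y = D a" by (auto simp: S_def)
      show "sc c y \<in> S" for c
        unfolding S_def a(3) D_sc[OF a(1)] by (rule imageI) (use a in \<open>auto simp: sc_def simp del: coord_scale_apply\<close>)
      fix z assume "z \<in> S"
      then obtain b where b: "\<forall>i. b i \<in> coord_space m" "\<forall>i\<ge>s. b i = 0" "z = D b" by (auto simp: S_def)
      show "y + z \<in> S"
        unfolding S_def a(3) b(3) D_add[OF a(1) b(1)]
      proof (rule imageI, intro CollectI conjI allI impI)
        show "(a + b) i \<in> coord_space m" for i
          unfolding plus_fun_apply[of a b i] using a(1) b(1) by blast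
        show "(a + b) i = 0" if "s \<le> i" for i
          using that a(2) b(2) by simp
      qed
    qed
  qed
  have "t \<notin> S"
  proof
    assume "t \<in> S"
    then obtain x where x: "\<And>i. x i \<in> coord_space m" "\<And>i. i \<ge> s \<Longrightarrow> x i = 0" "t = D x"
      by (auto simp: S_def)
    have x0: "B (x 0) = B (v (Suc 0))" using fun_cong[OF x(3), of 0] by (simp add: t_def D_def)
    have xs: "B (x (Suc i)) = A (x i)" for i using fun_cong[OF x(3), of "Suc i"] by (simp add: t_def D_def)
    define u where "u i = x i - v (Suc i)" for i
    have "pencil_chain m A B s u"
      unfolding pencil_chain_def u_def using x0 xs x(1,2) v' Suc
      by (simp add: linear_diff[OF A] linear_diff[OF B])
    then have "u s = 0" using short Suc by blast
    then show False using v(2) x(2) Suc by (simp add: u_def)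
  qed
  then obtain H where H: "\<And>y z. H (y + z) = H y + H z" "\<And>c y. H (sc c y) = c * H y"
      "\<And>y. y \<in> S \<Longrightarrow> H y = 0" "H t = 1"
    using separating_functional[OF sc.vector_space_axioms S] by metis
  define h where "h i w = H (\<lambda>k. if k = i then w else 0)" for i :: nat and w :: "nat \<Rightarrow> 'k"
  have h_add: "h i (w + z) = h i w + h i z" for i w z
    unfolding h_def H(1)[symmetric] by (rule arg_cong[of _ _ H]) (auto simp: fun_eq_iff)
  have h_scale: "h i (coord_scale c w) = c * h i w" for i c w
    unfolding h_def H(2)[symmetric] by (rule arg_cong[of _ _ H]) (auto simp: fun_eq_iff sc_def)
  have h_step: "h (Suc i) (A x) = h i (B x)" if "x \<in> coord_space m" "i < s" for i x
  proof -
    let ?x = "\<lambda>k. if k = i then x else 0"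
    have "D ?x \<in> S" unfolding S_def using that by auto
    then have "0 = H (D ?x)" by (simp add: H(3))
    also have "H (D ?x) + h (Suc i) (A x) = h i (B x)"
      unfolding h_def H(1)[symmetric]
      by (rule arg_cong[of _ _ H]) (auto simp: fun_eq_iff D_def linear_zero[OF A] linear_zero[OF B])
    finally show ?thesis by simp
  qed
  define g2 where "g2 w = (\<lambda>i. if i < r then h i w else 0)" for w
  define g1 where "g1 x = (\<lambda>i. if i < r then h i (A x) else if i = r then h s (B x) else 0)" for x
  show ?thesis
  proof (rule that[of g1 g2])
    show "rep_morphism (coord_rep m n A B) (I_rep r) g1 g2"
      unfolding I_rep_def coord_morphism_iff
    proof (intro conjI ballI)
      show "coord_linear m (r + 1) g1"
        unfolding linear_between_def g1_def
        by (auto simp: coord_space_def[of "Suc r"] fun_eq_iff linear_betweenD[OF A] linear_betweenD[OF B] h_add h_scale)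
      show "coord_linear n r g2"
        unfolding linear_between_def g2_def by (auto simp: coord_space_def[of r] fun_eq_iff h_add h_scale)
      fix x :: "nat \<Rightarrow> 'k" assume x: "x \<in> coord_space m"
      show "(\<lambda>i. if i < r then g1 x i else 0) = g2 (A x)" by (auto simp: g1_def g2_def)
      show "(\<lambda>i. g1 x (i + 1)) = g2 (B x)"
        using h_step[OF x] Suc by (auto simp: g1_def g2_def fun_eq_iff less_Suc_eq)
    qed
    have "g1 (v 0) 0 = H t" using v'(3)[of 0] Suc by (simp add: g1_def h_def t_def)
    then show "g1 (v 0) 0 \<noteq> 0" using H(4) by simp
  qed
qed

text \<open>
  The composition of the two morphisms is an endomorphism of $I_r$, hence a scalar, and evaluation at
  the first unit vector shows that the scalar is not zero.
\<close>

lemma chain_gives_I_retract: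
  fixes A B :: "(nat \<Rightarrow> 'k::field) \<Rightarrow> nat \<Rightarrow> 'k"
  assumes A: "coord_linear m n A" and B: "coord_linear m n B"
    and "pencil_chain m A B r0 v0" "v0 i0 \<noteq> 0"
  obtains r f1 f2 g1 g2 where
    "rep_morphism (I_rep r) (coord_rep m n A B) f1 f2" "rep_morphism (coord_rep m n A B) (I_rep r) g1 g2"
    "\<And>x. x \<in> coord_space (r + 1) \<Longrightarrow> g1 (f1 x) = x" "\<And>x. x \<in> coord_space r \<Longrightarrow> g2 (f2 x) = x"
proof -
  obtain r v where v: "pencil_chain m A B r v" "v r \<noteq> 0"
      "\<And>s u i. s < r \<Longrightarrow> pencil_chain m A B s u \<Longrightarrow> u i = 0"
    using shortest_chain[OF assms(3,4)] by metis
  obtain g1 g2 where g: "rep_morphism (coord_rep m n A B) (I_rep r) g1 g2" "g1 (v 0) 0 \<noteq> 0"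
    by (rule chain_functional[OF A B v(1,2)]) (use v(3) in blast)+
  let ?f1 = "\<lambda>x. \<Sum>i<r + 1. coord_scale (x i) (v i)" and ?f2 = "\<lambda>y. \<Sum>i<r. coord_scale (y i) (A (v i))"
  note f = chain_morphism[OF A B v(1)]
  obtain c where c: "\<And>x. x \<in> coord_space (r + 1) \<Longrightarrow> g1 (?f1 x) = coord_scale c x"
      "\<And>x. x \<in> coord_space r \<Longrightarrow> g2 (?f2 x) = coord_scale c x"
    using I_rep_endomorphism_scalar[OF rep_morphism_compose[OF is_rep_I_rep f g(1)]] by blast
  have "?f1 (unit_vec 0) = (\<Sum>i\<in>{0}. coord_scale (unit_vec 0 i) (v i))"
    by (rule sum.mono_neutral_right) auto
  then have "?f1 (unit_vec 0) = v 0" by simp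
  then have "g1 (v 0) 0 = c" using fun_cong[OF c(1)[of "unit_vec 0"], of 0] by simp
  then have nz: "c \<noteq> 0" using g(2) by simp
  have scaled: "rep_morphism (coord_rep m n A B) (I_rep r)
      (\<lambda>x. coord_scale (inverse c) (g1 x)) (\<lambda>x. coord_scale (inverse c) (g2 x))"
  proof (rule rep_morphism_compose[OF _ g(1)])
    show "is_rep (coord_rep m n A B)" using A B by (simp add: is_rep_coord_rep)
    show "rep_morphism (I_rep r) (I_rep r) (coord_scale (inverse c)) (coord_scale (inverse c))"
      by (auto simp: I_rep_def coord_morphism_iff linear_between_def fun_eq_iff algebra_simps)
  qed
  show ?thesis
    by (rule that[OF f scaled]) (use nz in \<open>simp_all only: c coord.scale_scale left_inverse[OF nz] coord.scale_one\<close>)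
qed

lemma transposed_chain_gives_P_retract:
  fixes A B :: "(nat \<Rightarrow> 'k::field) \<Rightarrow> nat \<Rightarrow> 'k"
  assumes A: "coord_linear m n A" and B: "coord_linear m n B"
    and "pencil_chain n (transposed m n A) (transposed m n B) r0 v0" "v0 i0 \<noteq> 0"
  obtains r f1 f2 g1 g2 where
    "rep_morphism (P_rep r) (coord_rep m n A B) f1 f2" "rep_morphism (coord_rep m n A B) (P_rep r) g1 g2"
    "\<And>x. x \<in> coord_space r \<Longrightarrow> g1 (f1 x) = x" "\<And>x. x \<in> coord_space (r + 1) \<Longrightarrow> g2 (f2 x) = x"
proof -
  obtain r f1 f2 g1 g2 where
    f: "rep_morphism (I_rep r) (coord_rep n m (transposed m n A) (transposed m n B)) f1 f2"
    and g: "rep_morphism (coord_rep n m (transposed m n A) (transposed m n B)) (I_rep r) g1 g2"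
    and gf: "\<And>x. x \<in> coord_space (r + 1) \<Longrightarrow> g1 (f1 x) = x" "\<And>x. x \<in> coord_space r \<Longrightarrow> g2 (f2 x) = x"
    using chain_gives_I_retract[OF transposed_linear transposed_linear assms(3,4)] by metis
  have lin: "coord_linear (r + 1) n f1" "coord_linear r m f2" "coord_linear n (r + 1) g1" "coord_linear m r g2"
    using f g by (auto simp: I_rep_def coord_morphism_iff)
  have id: "transposed l k f (transposed k l g x) = x"
    if "coord_linear l k f" "coord_linear k l g" "\<And>x. x \<in> coord_space l \<Longrightarrow> g (f x) = x" "x \<in> coord_space l" for l k f g x
    using transposed_compose[OF that(1,2), of x] transposed_cong[of l "\<lambda>x. g (f x)" "\<lambda>x. x" l] that(3)
      transposed_ident[OF that(4)] by simp
  show ?thesis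
  proof (rule that)
    show "rep_morphism (P_rep r) (coord_rep m n A B) (transposed m r g2) (transposed n (r + 1) g1)"
      using morphism_into_I_rep_transposed[OF transposed_linear transposed_linear g]
      unfolding P_rep_def
      by (subst (asm) coord_morphism_cong) (auto simp: transposed_transposed[OF A] transposed_transposed[OF B])
    show "rep_morphism (coord_rep m n A B) (P_rep r) (transposed r m f2) (transposed (r + 1) n f1)"
      using morphism_from_I_rep_transposed[OF transposed_linear transposed_linear f]
      unfolding P_rep_def
      by (subst (asm) coord_morphism_cong) (auto simp: transposed_transposed[OF A] transposed_transposed[OF B])
  qed (use id lin gf in blast)+
qed

section \<open>Regular pencils\<close>

text \<open>Over a finite field, the product of all $z - a$, plus 1, has no root.\<close>

lemma infinite_alg_closed_field: "infinite (UNIV :: 'k::alg_closed_field set)"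
proof
  assume fin: "finite (UNIV :: 'k set)"
  define p where "p = (\<Prod>a\<in>(UNIV :: 'k set). [:- a, 1:]) + 1"
  have "degree (\<Prod>a\<in>(UNIV :: 'k set). [:- a, 1:]) = card (UNIV :: 'k set)"
    by (subst degree_prod_eq_sum_degree) auto
  then have "degree p > 0"
    unfolding p_def using fin by (subst degree_add_eq_left) (simp_all add: card_gt_0_iff)
  then obtain x where "poly p x = 0" using alg_closed_imp_poly_has_root by blast
  moreover have "(\<Prod>a\<in>(UNIV :: 'k set). x - a) = 0" using fin by (subst prod_zero_iff) auto
  ultimately show False by (simp add: p_def poly_prod)
qed

text \<open>
  Choose a non-zero polynomial of minimal degree with $p(S) e = 0$ for a fixed $e \neq 0$, and write
  $p = (z - a) q$. Then $q(S) e$ is an eigenvector for $a$; it is not zero by minimality.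
\<close>

lemma eigenvector_exists:
  fixes S :: "(nat \<Rightarrow> 'k::alg_closed_field) \<Rightarrow> nat \<Rightarrow> 'k"
  assumes S: "coord_linear m m S" and m: "m \<ge> 1"
  obtains a x where "x \<in> coord_space m" "x \<noteq> 0" "S x = coord_scale a x"
proof -
  let ?e = "unit_vec 0 :: nat \<Rightarrow> 'k"
  have e: "?e \<in> coord_space m" "?e \<noteq> 0" using m by (auto simp: fun_eq_iff)
  have pow: "(S ^^ i) ?e \<in> coord_space m" for i
    using linear_betweenD(1)[OF linear_funpow[OF S] e(1)] .
  \<comment> \<open>\<open>p(S) e\<close> for polynomials of degree at most \<open>m\<close>, with a summation range that does not depend on \<open>p\<close>\<close>
  define ev where "ev p = (\<Sum>i<Suc m. coord_scale (coeff p i) ((S ^^ i) ?e))" for p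
  have ev: "ev p \<in> coord_space m" for p unfolding ev_def by (intro coord_space_sum coord_space_closed pow)
  obtain c where c: "\<exists>i<Suc m. c i \<noteq> 0" "(\<Sum>i<Suc m. coord_scale (c i) ((S ^^ i) ?e)) = 0"
    by (rule coord_dependent[of "Suc m" "\<lambda>i. (S ^^ i) ?e" m, OF pow]) simp_all
  define p0 where "p0 = (\<Sum>i<Suc m. monom (c i) i)"
  have coeff_p0: "coeff p0 i = (if i < Suc m then c i else 0)" for i
    unfolding p0_def by (simp add: coeff_sum del: sum.lessThan_Suc)
  have "ev p0 = (\<Sum>i<Suc m. coord_scale (c i) ((S ^^ i) ?e))"
    unfolding ev_def by (rule sum.cong) (simp_all add: coeff_p0 del: coord_scale_apply)
  then have "ev p0 = 0" using c(2) by simp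
  moreover have "p0 \<noteq> 0" using c(1) by (metis coeff_0 coeff_p0)
  moreover have "degree p0 \<le> m" by (rule degree_le) (simp add: coeff_p0)
  ultimately have "\<exists>d p. degree p = d \<and> p \<noteq> 0 \<and> d \<le> m \<and> ev p = 0" by blast
  then obtain d where d: "\<exists>p. degree p = d \<and> p \<noteq> 0 \<and> d \<le> m \<and> ev p = 0"
      and least: "\<And>q. degree q < d \<Longrightarrow> q \<noteq> 0 \<Longrightarrow> degree q \<le> m \<Longrightarrow> ev q \<noteq> 0"
    using exists_least_iff[of "\<lambda>d. \<exists>p. degree p = d \<and> p \<noteq> 0 \<and> d \<le> m \<and> ev p = 0"] by auto
  then obtain p where p: "degree p = d" "p \<noteq> 0" "d \<le> m" "ev p = 0" by blast
  have "d > 0"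
  proof (rule ccontr)
    assume "\<not> d > 0"
    then have "degree p = 0" using p(1) by simp
    then obtain b where b: "p = [:b:]" by (auto elim: degree_eq_zeroE)
    have "ev p = (\<Sum>i\<in>{0}. coord_scale (coeff p i) ((S ^^ i) ?e))"
      unfolding ev_def b by (rule sum.mono_neutral_right) (auto simp: coeff_pCons split: nat.splits simp del: coord_scale_apply)
    then have "coord_scale b ?e = 0" using p(4) b by simp
    then show False using e(2) p(2) b by (simp add: coord.scale_eq_0_iff del: coord_scale_apply)
  qed
  then obtain a where "poly p a = 0" using alg_closed_imp_poly_has_root p(1) by blast
  then obtain q where q: "p = [:- a, 1:] * q" by (auto simp: poly_eq_0_iff_dvd elim: dvdE)
  have q0: "q \<noteq> 0" using p(2) q by auto
  have "degree p = degree [:- a, 1:] + degree q" unfolding q by (rule degree_mult_eq) (use q0 in auto)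
  then have dq: "degree q < d" using p(1) by simp
  then have top: "coeff q m = 0" using p(3) by (intro coeff_eq_0) simp
  have coeff_p: "coeff p i = coeff (pCons 0 q) i - a * coeff q i" for i
    by (simp add: q)
  have "S (ev q) = (\<Sum>i<Suc m. coord_scale (coeff q i) ((S ^^ Suc i) ?e))"
    unfolding ev_def by (subst linear_sum[OF S pow]) simp
  also have "\<dots> = (\<Sum>i<m. coord_scale (coeff q i) ((S ^^ Suc i) ?e))"
    using top by simp
  also have "\<dots> = (\<Sum>i<Suc m. coord_scale (coeff (pCons 0 q) i) ((S ^^ i) ?e))"
    by (simp only: sum.lessThan_Suc_shift) (simp del: coord_scale_apply funpow.simps)
  finally have "S (ev q) - coord_scale a (ev q) = ev p"
    unfolding ev_def coord.scale_sum_right coord.scale_scale coeff_p coord.scale_left_diff_distrib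
    by (simp only: sum_subtractf)
  then have "S (ev q) = coord_scale a (ev q)" using p(4) by simp
  moreover have "ev q \<noteq> 0" using least[OF dq q0] dq p(3) by simp
  ultimately show ?thesis using that ev by blast
qed

text \<open>
  By Fitting's lemma, subtracting an eigenvalue from \<open>S\<close> leaves a nilpotent operator \<open>N\<close>. Let \<open>p\<close> be its
  order of nilpotency, \<open>u\<close> a vector with \<open>(N ^^ (p - 1)) u \<noteq> 0\<close>, and \<open>H\<close> a functional with value 1 there.
  The vectors \<open>(N ^^ i) u\<close> give a morphism from the Jordan block of size \<open>p\<close>, and the functionals
  \<open>\<lambda>v. H ((N ^^ i) v)\<close> give one back to it. Their composition fixes the first unit vector,
  so its kernel is an invariant subspace without that vector, hence zero: the
  Jordan block is a direct summand.
\<close>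

lemma indecomposable_operator_jordan:
  fixes S :: "(nat \<Rightarrow> 'k::alg_closed_field) \<Rightarrow> nat \<Rightarrow> 'k"
  assumes X: "indecomposable (coord_rep m m (\<lambda>v. v) S)"
  obtains p b where "p \<ge> 1" "rep_iso (coord_rep m m (\<lambda>v. v) S) (coord_rep p p (\<lambda>v. v) (jordan_map b))"
proof -
  let ?X = "coord_rep m m (\<lambda>v. v) S"
  have S: "coord_linear m m S" and nz: "m \<ge> 1"
    using X by (auto simp: indecomposable_def is_rep_coord_rep zero_coord_rep_iff)
  obtain b x where x: "x \<in> coord_space m" "x \<noteq> 0" "S x = coord_scale b x"
    using eigenvector_exists[OF S nz] .
  define N where "N v = S v - coord_scale b v" for v
  note S' = linear_betweenD[OF S]
  have S_N: "S v = N v + coord_scale b v" for v by (simp add: N_def)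
  have N: "coord_linear m m N"
    unfolding linear_between_def N_def
    by (auto simp: S' coord.scale_right_distrib coord.scale_right_diff_distrib mult.commute simp del: coord_scale_apply)
  have "N x = 0" using x(3) by (simp add: N_def)
  moreover have "rep_morphism ?X ?X N N"
    by (simp add: coord_morphism_iff N N_def linear_diff[OF S] S' del: coord_scale_apply)
  ultimately obtain K where "\<forall>v\<in>coord_space m. (N ^^ K) v = 0"
    using fitting[OF X _ x(1,2)] by blast
  then obtain p where p: "\<forall>v\<in>coord_space m. (N ^^ p) v = 0"
    and least: "\<And>q. q < p \<Longrightarrow> \<not> (\<forall>v\<in>coord_space m. (N ^^ q) v = 0)"
    using exists_least_iff[of "\<lambda>q. \<forall>v\<in>coord_space m. (N ^^ q) v = 0"] by auto
  have "p \<noteq> 0"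
  proof
    assume "p = 0"
    then have "x = 0" using bspec[OF p x(1)] by simp
    then show False using x(2) by contradiction
  qed
  then obtain q where q: "p = Suc q" by (cases p) auto
  obtain u where u: "u \<in> coord_space m" "(N ^^ q) u \<noteq> 0" using least[of q] q by blast
  have pow: "(N ^^ i) v \<in> coord_space m" if "v \<in> coord_space m" for i v
    using linear_betweenD(1)[OF linear_funpow[OF N] that] .
  have zero: "(N ^^ i) v = 0" if "i \<ge> p" "v \<in> coord_space m" for i v
  proof -
    have "(N ^^ i) v = (N ^^ (i - p)) ((N ^^ p) v)" using that(1) by (simp flip: funpow_add[THEN fun_cong, unfolded o_apply])
    then show ?thesis using p that(2) linear_zero[OF linear_funpow[OF N]] by simp
  qed
  have "(N ^^ q) u \<notin> {0}" using u(2) by simp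
  then obtain H where H: "\<And>y z. H (y + z) = H y + H z" "\<And>c y. H (coord_scale c y) = c * H y" "H ((N ^^ q) u) = 1"
    using separating_functional[OF coord.vector_space_axioms coord.subspace_single_0] by metis
  have H0: "H 0 = 0" using H(2)[of 0 0] by (simp only: coord.scale_zero_left mult_zero_left)
  define g where "g v = (\<lambda>i. if i < p then H ((N ^^ i) v) else 0)" for v
  define f where "f c = (\<Sum>j<p. coord_scale (c j) ((N ^^ (q - j)) u))" for c
  let ?Y = "coord_rep p p (\<lambda>v. v) (jordan_map b)"
  note Np = linear_betweenD[OF linear_funpow[OF N]]
  have g: "rep_morphism ?X ?Y g g"
    unfolding coord_morphism_iff
  proof (intro conjI ballI)
    show lin: "coord_linear m p g" "coord_linear m p g"
      unfolding linear_between_def g_def by (auto simp: Np H coord_space_def[of p] fun_eq_iff)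
    fix v :: "nat \<Rightarrow> 'k" assume v: "v \<in> coord_space m"
    show "jordan_map b (g v) = g (S v)"
    proof
      fix i
      have "(N ^^ i) (S v) = (N ^^ Suc i) v + coord_scale b ((N ^^ i) v)"
        unfolding S_N[of v]
        using Np(2)[of "N v" "coord_scale b v" i] Np(3)[OF v, of i b] linear_betweenD(1)[OF N v] v
        by (simp add: funpow_swap1 del: coord_scale_apply)
      then have *: "H ((N ^^ i) (S v)) = H ((N ^^ Suc i) v) + b * H ((N ^^ i) v)" by (simp only: H)
      show "jordan_map b (g v) i = g (S v) i"
        using * zero[of "Suc i" v] v H0 by (cases "Suc i < p") (auto simp: jordan_map_def g_def not_less)
    qed
  qed simp
  have f: "rep_morphism ?Y ?X f f"
    unfolding coord_morphism_iff
  proof (intro conjI ballI)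
    show lin: "coord_linear p m f" "coord_linear p m f"
      unfolding f_def by (intro combination_linear pow u)+
    fix c :: "nat \<Rightarrow> 'k" assume c: "c \<in> coord_space p"
    have "N (f c) = (\<Sum>j<p. coord_scale (c j) (N ((N ^^ (q - j)) u)))"
      unfolding f_def by (rule linear_sum[OF N]) (rule pow[OF u(1)])
    also have "\<dots> = (\<Sum>j<p. coord_scale (c j) ((N ^^ (Suc q - j)) u))"
      by (rule sum.cong) (auto simp: q Suc_diff_le simp del: coord_scale_apply)
    also have "\<dots> = (\<Sum>j<q. coord_scale (c (Suc j)) ((N ^^ (q - j)) u))"
      unfolding q sum.lessThan_Suc_shift using zero[of "Suc q" u] u q by (simp del: funpow.simps coord_scale_apply)
    also have "\<dots> = f (\<lambda>j. c (Suc j))"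
      using c by (simp add: f_def q coord_space_def)
    finally have Nf: "N (f c) = f (\<lambda>j. c (Suc j))" .
    have shift: "(\<lambda>j. c (Suc j)) \<in> coord_space p" using c by (auto simp: coord_space_def)
    have "jordan_map b c = (\<lambda>j. c (Suc j)) + coord_scale b c" by (auto simp: jordan_map_def fun_eq_iff)
    then have "f (jordan_map b c) = f (\<lambda>j. c (Suc j)) + coord_scale b (f c)"
      using linear_betweenD(2)[OF lin(1) shift, of "coord_scale b c"] linear_betweenD(3)[OF lin(1) c] c
      by (simp del: coord_scale_apply)
    then show "S (f c) = f (jordan_map b c)" by (simp only: S_N Nf)
  qed simp
  have Y: "is_rep ?Y" "\<not> zero_rep ?Y"
    using \<open>p \<noteq> 0\<close> by (simp_all add: is_rep_coord_rep jordan_map_linear linear_between_ident zero_coord_rep_iff)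
  have gf: "rep_morphism ?Y ?Y (\<lambda>c. g (f c)) (\<lambda>c. g (f c))" by (rule rep_morphism_compose[OF Y(1) f g])
  then have gf_lin: "coord_linear p p (\<lambda>c. g (f c))"
    and gf_jordan: "\<And>c. c \<in> coord_space p \<Longrightarrow> g (f (jordan_map b c)) = jordan_map b (g (f c))"
    by (auto simp: coord_morphism_iff)
  have bij: "bij_betw (\<lambda>c. g (f c)) (coord_space p) (coord_space p)"
  proof (rule linear_injective_bij[OF gf_lin])
    fix c assume c: "c \<in> coord_space p" "g (f c) = 0"
    let ?K = "{c \<in> coord_space p. g (f c) = 0}"
    have "f (unit_vec 0) = (\<Sum>j\<in>{0}. coord_scale (unit_vec 0 j) ((N ^^ (q - j)) u))"
      unfolding f_def using q by (intro sum.mono_neutral_right) auto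
    then have "g (f (unit_vec 0)) 0 = 1" using H(3) q by (simp add: g_def)
    then have not: "unit_vec 0 \<notin> ?K" by auto
    show "c = 0"
    proof (rule ccontr)
      assume "c \<noteq> 0"
      moreover have "coord.subspace ?K"
        using linear_zero[OF gf_lin] by (auto simp: coord.subspace_def linear_betweenD[OF gf_lin])
      moreover have "jordan_map b c \<in> ?K" if "c \<in> ?K" for c
        using that gf_jordan[of c] linear_betweenD(1)[OF jordan_map_linear, of c] linear_zero[OF jordan_map_linear]
        by simp
      ultimately have "unit_vec 0 \<in> ?K"
        using c by (intro jordan_invariant_contains_first_unit[of ?K p b c]) auto
      then show False using not by blast
    qed
  qed
  have "rep_iso ?X ?Y"
    unfolding rep_iso_def using g indecomposable_retract[OF X Y f g] bij by auto
  then show ?thesis using that[of p b] \<open>p \<noteq> 0\<close> by simp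
qed

text \<open>Composing with the inverse of the first arrow turns that arrow into the identity.\<close>

lemma indecomposable_invertible_arrow:
  fixes A B :: "(nat \<Rightarrow> 'k::alg_closed_field) \<Rightarrow> nat \<Rightarrow> 'k"
  assumes X: "indecomposable (coord_rep m m A B)"
    and inj: "\<And>x. x \<in> coord_space m \<Longrightarrow> A x = 0 \<Longrightarrow> x = 0"
  obtains p b where "p \<ge> 1" "rep_iso (coord_rep m m A B) (coord_rep p p (\<lambda>v. v) (jordan_map b))"
proof -
  have rX: "is_rep (coord_rep m m A B)" using X by (simp add: indecomposable_def)
  then have A: "coord_linear m m A" and B: "coord_linear m m B" by (simp_all add: is_rep_coord_rep)
  have bij: "bij_betw A (coord_space m) (coord_space m)" by (rule linear_injective_bij[OF A inj])
  let ?A' = "inv_into (coord_space m) A"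
  have A': "coord_linear m m ?A'"
    by (rule linear_between_inverse[OF A bij coord.vector_space_axioms subspace_coord_space])
  let ?Y = "coord_rep m m (\<lambda>v. v) (\<lambda>x. ?A' (B x))"
  have "rep_morphism (coord_rep m m A B) ?Y (\<lambda>v. v) ?A'"
    using bij by (simp add: coord_morphism_iff A' linear_between_ident bij_betw_inv_into_left)
  then have iso: "rep_iso (coord_rep m m A B) ?Y"
    unfolding rep_iso_def using bij_betw_inv_into[OF bij] bij_betw_id[unfolded id_def] by (auto intro!: exI)
  have "is_rep ?Y" by (simp add: is_rep_coord_rep linear_between_ident linear_between_compose[OF B A'])
  then have "indecomposable ?Y" using indecomposable_iso[OF X _ iso] by blast
  then obtain p b where "p \<ge> 1" "rep_iso ?Y (coord_rep p p (\<lambda>v. v) (jordan_map b))"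
    by (rule indecomposable_operator_jordan)
  then show ?thesis using that rep_iso_trans[OF rX iso] by blast
qed

definition swap_arrows :: "('k, 'a, 'b) kronecker_rep \<Rightarrow> ('k, 'a, 'b) kronecker_rep" where
  "swap_arrows X = X\<lparr>arrow1 := arrow2 X, arrow2 := arrow1 X\<rparr>"

lemma swap_coord_rep: "swap_arrows (coord_rep m n A B) = coord_rep m n B A"
  by (simp add: swap_arrows_def coord_rep_def)

lemma swap_arrows_simps:
  "swap_arrows (swap_arrows X) = X"
  "is_rep (swap_arrows X) \<longleftrightarrow> is_rep X"
  "zero_rep (swap_arrows X) \<longleftrightarrow> zero_rep X"
  "rep_iso (swap_arrows X) (swap_arrows Y) \<longleftrightarrow> rep_iso X Y"
  "swap_arrows (rep_sum X Y) = rep_sum (swap_arrows X) (swap_arrows Y)"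
  by (auto simp: swap_arrows_def is_rep_def zero_rep_def rep_sum_def rep_iso_def rep_morphism_def)

text \<open>
  Exchanging the arrows reduces the case of an invertible second arrow to that of an invertible first
  arrow, and exchanges the two kinds of representations by which $R_{p,\lambda}$ is described.
\<close>

lemma indecomposable_swap_arrows:
  fixes X :: "('k::field, 'a::ab_group_add, 'b::ab_group_add) kronecker_rep"
  assumes "indecomposable X"
  shows "indecomposable (swap_arrows X)"
proof -
  have "rep_iso X (rep_sum (swap_arrows Y) (swap_arrows Z))"
    if "rep_iso (swap_arrows X) (rep_sum Y Z)" for Y Z :: "('k, 'a, 'b) kronecker_rep"
    using that swap_arrows_simps(4)[of X "swap_arrows (rep_sum Y Z)"] by (simp add: swap_arrows_simps)
  then show ?thesis using assms unfolding indecomposable_def by (metis swap_arrows_simps(2,3))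
qed

text \<open>
  In an indecomposable regular pencil, one of the arrows is invertible. With \<open>C = A - \<mu> B\<close> invertible,
  $C^{-1} B$ and $B C^{-1}$ form an endomorphism; if \<open>B\<close> has a kernel, so does $T = C^{-1} B$, which is
  then nilpotent by Fitting's lemma. Since $C^{-1} A = 1 + \mu T$, the kernel of \<open>A\<close> is trivial.
\<close>

lemma regular_pencil_invertible_arrow:
  assumes X: "indecomposable (coord_rep m m A B)"
    and reg: "\<And>x. x \<in> coord_space m \<Longrightarrow> A x = coord_scale \<mu> (B x) \<Longrightarrow> x = 0"
    and y: "y \<in> coord_space m" "B y = 0" "y \<noteq> 0" and x: "x \<in> coord_space m" "A x = 0"
  shows "x = 0"
proof -
  let ?X = "coord_rep m m A B"
  have A: "coord_linear m m A" and B: "coord_linear m m B"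
    using X by (simp_all add: indecomposable_def is_rep_coord_rep)
  define C where "C v = A v - coord_scale \<mu> (B v)" for v
  have A_C: "A v = C v + coord_scale \<mu> (B v)" for v by (simp add: C_def)
  have C: "coord_linear m m C"
    unfolding linear_between_def C_def
    by (auto simp: linear_betweenD[OF A] linear_betweenD[OF B] coord.scale_right_distrib
        coord.scale_right_diff_distrib mult.commute simp del: coord_scale_apply)
  have bij: "bij_betw C (coord_space m) (coord_space m)"
    by (rule linear_injective_bij[OF C]) (simp add: C_def reg)
  let ?C' = "inv_into (coord_space m) C"
  have C': "coord_linear m m ?C'"
    by (rule linear_between_inverse[OF C bij coord.vector_space_axioms subspace_coord_space])
  have C'C: "?C' (C v) = v" if "v \<in> coord_space m" for v
    using bij that by (simp add: bij_betw_inv_into_left)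
  have CC': "C (?C' v) = v" if "v \<in> coord_space m" for v
    using bij that by (simp add: bij_betw_inv_into_right)
  let ?T = "\<lambda>v. ?C' (B v)" and ?U = "\<lambda>w. B (?C' w)"
  have T: "coord_linear m m ?T" and U: "coord_linear m m ?U"
    by (rule linear_between_compose[OF B C'], rule linear_between_compose[OF C' B])
  have "A (?T v) = ?U (A v)" if v: "v \<in> coord_space m" for v
  proof -
    have Bv: "B v \<in> coord_space m" and Cv: "C v \<in> coord_space m"
      using linear_betweenD(1)[OF B v] linear_betweenD(1)[OF C v] .
    have "?U (A v) = ?U (C v) + coord_scale \<mu> (?U (B v))"
      unfolding A_C[of v]
      using linear_betweenD(2)[OF U Cv, of "coord_scale \<mu> (B v)"] linear_betweenD(3)[OF U Bv] Bv
      by (simp del: coord_scale_apply)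
    also have "\<dots> = A (?T v)" unfolding A_C[of "?T v"] by (simp add: C'C[OF v] CC'[OF Bv] del: coord_scale_apply)
    finally show ?thesis by simp
  qed
  then have "rep_morphism ?X ?X ?T ?U" using T U by (simp add: coord_morphism_iff)
  moreover have "?T y = 0" using y(2) linear_zero[OF C'] by simp
  ultimately obtain K where K: "\<forall>v\<in>coord_space m. (?T ^^ K) v = 0"
    using fitting[OF X _ y(1,3), of ?T ?U] by blast
  have "C x = coord_scale (- \<mu>) (B x)" using x(2) by (simp add: C_def)
  then have step: "x = coord_scale (- \<mu>) (?T x)"
    using C'C[OF x(1)] linear_betweenD(3)[OF C' linear_betweenD(1)[OF B x(1)]] by metis
  have Tpow: "(?T ^^ i) x \<in> coord_space m" for i using linear_betweenD(1)[OF linear_funpow[OF T] x(1)] .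
  have "x = coord_scale ((- \<mu>) ^ i) ((?T ^^ i) x)" for i
  proof (induction i)
    case (Suc i)
    have "coord_scale ((- \<mu>) ^ Suc i) ((?T ^^ Suc i) x) = coord_scale (- \<mu>) (?T (coord_scale ((- \<mu>) ^ i) ((?T ^^ i) x)))"
      using linear_betweenD(3)[OF T Tpow] by (simp add: mult.assoc del: coord_scale_apply)
    also have "\<dots> = coord_scale (- \<mu>) (?T x)" by (simp only: Suc[symmetric])
    also have "\<dots> = x" by (rule step[symmetric])
    finally show ?case by (rule sym)
  qed simp
  then have "x = coord_scale ((- \<mu>) ^ K) ((?T ^^ K) x)" .
  also have "(?T ^^ K) x = 0" using K x(1) by blast
  finally show ?thesis by (simp only: coord.scale_zero_right)
qed

section \<open>Passing to coordinates\<close>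

lemma span_coordinates:
  fixes s :: "'k::field \<Rightarrow> 'a::ab_group_add \<Rightarrow> 'a"
  assumes "vector_space s" "finite S" "V = module.span s S"
  obtains m \<phi> where "linear_between coord_scale (coord_space m) s V \<phi>" "bij_betw \<phi> (coord_space m) V"
proof -
  interpret vector_space s by fact
  obtain Bs where Bs: "Bs \<subseteq> S" "independent Bs" "S \<subseteq> span Bs"
    by (rule maximal_independent_subset)
  have fin: "finite Bs" using Bs(1) assms(2) by (rule finite_subset)
  have V: "V = span Bs"
    unfolding assms(3) using Bs(1,3) span_mono span_minimal[OF _ subspace_span] by blast
  define m where "m = card Bs"
  obtain h where h: "bij_betw h {..<m} Bs"
    using ex_bij_betw_nat_finite[OF fin] by (auto simp: m_def atLeast0LessThan)
  define \<phi> where "\<phi> c = (\<Sum>i<m. s (c i) (h i))" for c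
  have hB: "h i \<in> Bs" if "i < m" for i using h that by (auto simp: bij_betw_def)
  have sum_h: "(\<Sum>v\<in>Bs. s (u v) v) = (\<Sum>i<m. s (u (h i)) (h i))" for u
    using sum.reindex_bij_betw[OF h, of "\<lambda>v. s (u v) v"] by simp
  have lin: "linear_between coord_scale (coord_space m) s V \<phi>"
    unfolding linear_between_def
  proof (intro conjI ballI allI)
    fix x y :: "nat \<Rightarrow> 'k" and c
    show "\<phi> x \<in> V" unfolding V \<phi>_def by (intro span_sum span_scale span_base hB) simp
    show "\<phi> (x + y) = \<phi> x + \<phi> y" by (simp add: \<phi>_def scale_left_distrib sum.distrib)
    show "\<phi> (coord_scale c x) = s c (\<phi> x)" by (simp add: \<phi>_def scale_sum_right)
  qed
  have inj: "inj_on \<phi> (coord_space m)"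
  proof (rule inj_onI)
    fix x y assume xy: "x \<in> coord_space m" "y \<in> coord_space m" "\<phi> x = \<phi> y"
    define u where "u v = x (inv_into {..<m} h v) - y (inv_into {..<m} h v)" for v
    have u: "u (h i) = x i - y i" if "i < m" for i
      using h that by (simp add: u_def bij_betw_inv_into_left)
    have "(\<Sum>v\<in>Bs. s (u v) v) = \<phi> x - \<phi> y"
      unfolding sum_h \<phi>_def by (simp add: u scale_left_diff_distrib sum_subtractf)
    then have "u v = 0" if "v \<in> Bs" for v
      using independentD[OF Bs(2) fin order_refl _ that] xy(3) by simp
    then have "x i = y i" if "i < m" for i using u[OF that] hB[OF that] by simp
    then show "x = y" using xy(1,2) by (auto simp: coord_space_def fun_eq_iff not_less) (metis not_less)
  qed
  have "v \<in> \<phi> ` coord_space m" if v: "v \<in> V" for v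
  proof -
    obtain u where u: "v = (\<Sum>b\<in>Bs. s (u b) b)" using v unfolding V span_finite[OF fin] by blast
    let ?c = "\<lambda>i. if i < m then u (h i) else 0"
    have "v = \<phi> ?c" unfolding u sum_h \<phi>_def by simp
    moreover have "?c \<in> coord_space m" by (simp add: coord_space_def)
    ultimately show ?thesis by blast
  qed
  then have "bij_betw \<phi> (coord_space m) V"
    using inj linear_betweenD(1)[OF lin] by (auto simp: bij_betw_def)
  then show ?thesis using that lin by blast
qed

lemma fin_dim_rep_coordinates:
  fixes X :: "('k::field, 'a::ab_group_add, 'b::ab_group_add) kronecker_rep"
  assumes X: "is_rep X" "fin_dim_rep X"
  obtains m n A B where "is_rep (coord_rep m n A B)" "rep_iso X (coord_rep m n A B)"
proof -
  note x = is_repD[OF X(1)]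
  obtain m \<phi> where \<phi>: "linear_between coord_scale (coord_space m) (scale1 X) (space1 X) \<phi>"
      "bij_betw \<phi> (coord_space m) (space1 X)"
    using X(2) span_coordinates[OF x(1)] unfolding fin_dim_rep_def by metis
  obtain n \<psi> where \<psi>: "linear_between coord_scale (coord_space n) (scale2 X) (space2 X) \<psi>"
      "bij_betw \<psi> (coord_space n) (space2 X)"
    using X(2) span_coordinates[OF x(3)] unfolding fin_dim_rep_def by metis
  let ?\<psi>' = "inv_into (coord_space n) \<psi>"
  have \<psi>': "linear_between (scale2 X) (space2 X) coord_scale (coord_space n) ?\<psi>'"
    by (rule linear_between_inverse[OF \<psi> coord.vector_space_axioms subspace_coord_space])
  let ?Y = "coord_rep m n (\<lambda>v. ?\<psi>' (arrow1 X (\<phi> v))) (\<lambda>v. ?\<psi>' (arrow2 X (\<phi> v)))"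
  have Y: "is_rep ?Y"
    unfolding is_rep_coord_rep
    by (intro conjI linear_between_compose[OF linear_between_compose[OF \<phi>(1) x(5)] \<psi>']
        linear_between_compose[OF linear_between_compose[OF \<phi>(1) x(6)] \<psi>'])
  have "\<psi> (?\<psi>' w) = w" if "w \<in> space2 X" for w
    using \<psi>(2) that by (metis bij_betw_inv_into_right)
  then have "rep_morphism ?Y X \<phi> \<psi>"
    unfolding rep_morphism_def
    using \<phi>(1) \<psi>(1) linear_betweenD(1)[OF x(5)] linear_betweenD(1)[OF x(6)] linear_betweenD(1)[OF \<phi>(1)]
    by simp
  then have "rep_iso ?Y X" unfolding rep_iso_def using \<phi>(2) \<psi>(2) by auto
  then show ?thesis using that[OF Y] rep_iso_sym[OF Y] by blast
qed

section \<open>The classification\<close>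

lemma proj_point_in_proj_line: "(a, b) \<noteq> (0, 0) \<Longrightarrow> proj_point a b \<in> proj_line"
  unfolding proj_point_def proj_line_def by (rule quotientI) simp

text \<open>
  The three cases: no \<open>A - \<mu> B\<close> is injective, no transpose of an \<open>A - \<mu> B\<close> is injective, or some \<open>A - \<mu> B\<close>
  and some transpose are, which makes both spaces of the same dimension.
\<close>

lemma coord_classification:
  fixes A B :: "(nat \<Rightarrow> 'k::alg_closed_field) \<Rightarrow> nat \<Rightarrow> 'k"
  assumes X: "indecomposable (coord_rep m n A B)"
  shows "(\<exists>r. rep_iso (coord_rep m n A B) (P_rep r)) \<or> (\<exists>r. rep_iso (coord_rep m n A B) (I_rep r)) \<or>
    (\<exists>p\<ge>1. \<exists>l\<in>proj_line. \<exists>R\<in>R_reps p l. rep_iso (coord_rep m n A B) R)"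
proof -
  let ?X = "coord_rep m n A B"
  have A: "coord_linear m n A" and B: "coord_linear m n B"
    using X by (simp_all add: indecomposable_def is_rep_coord_rep)
  note inf = infinite_alg_closed_field[where 'k = 'k]
  let ?sing = "\<lambda>m A B. \<forall>\<mu>. \<exists>u\<in>coord_space m. u \<noteq> 0 \<and> A u = coord_scale \<mu> (B u)"
  let ?A' = "transposed m n A" and ?B' = "transposed m n B"
  consider "?sing m A B" | "?sing n ?A' ?B'" | "\<not> ?sing m A B" "\<not> ?sing n ?A' ?B'" by blast
  then show ?thesis
  proof cases
    case 1
    then obtain r0 v0 i0 where "pencil_chain m A B r0 v0" "v0 i0 \<noteq> 0"
      using singular_pencil_has_chain[OF inf A B] by blast
    then obtain r f1 f2 g1 g2 where fg: "rep_morphism (I_rep r) ?X f1 f2" "rep_morphism ?X (I_rep r) g1 g2"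
      "\<And>x. x \<in> coord_space (r + 1) \<Longrightarrow> g1 (f1 x) = x" "\<And>x. x \<in> coord_space r \<Longrightarrow> g2 (f2 x) = x"
      by (rule chain_gives_I_retract[OF A B]) (rule that)
    have "\<not> zero_rep (I_rep r :: ('k, nat \<Rightarrow> 'k, nat \<Rightarrow> 'k) kronecker_rep)"
      by (simp add: I_rep_def zero_coord_rep_iff)
    then have "rep_iso ?X (I_rep r)"
      unfolding rep_iso_def
      using fg(2) indecomposable_retract_ident[OF X is_rep_I_rep _ fg(1,2)] fg(3,4)
      by (auto simp: I_rep_def)
    then show ?thesis by blast
  next
    case 2
    then obtain r0 v0 i0 where "pencil_chain n ?A' ?B' r0 v0" "v0 i0 \<noteq> 0"
      using singular_pencil_has_chain[OF inf transposed_linear transposed_linear] by blast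
    then obtain r f1 f2 g1 g2 where fg: "rep_morphism (P_rep r) ?X f1 f2" "rep_morphism ?X (P_rep r) g1 g2"
      "\<And>x. x \<in> coord_space r \<Longrightarrow> g1 (f1 x) = x" "\<And>x. x \<in> coord_space (r + 1) \<Longrightarrow> g2 (f2 x) = x"
      by (rule transposed_chain_gives_P_retract[OF A B]) (rule that)
    have "\<not> zero_rep (P_rep r :: ('k, nat \<Rightarrow> 'k, nat \<Rightarrow> 'k) kronecker_rep)"
      by (simp add: P_rep_def zero_coord_rep_iff)
    then have "rep_iso ?X (P_rep r)"
      unfolding rep_iso_def
      using fg(2) indecomposable_retract_ident[OF X is_rep_P_rep _ fg(1,2)] fg(3,4)
      by (auto simp: P_rep_def)
    then show ?thesis by blast
  next
    case 3
    have le: "k \<le> l"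
      if f: "coord_linear k l f" and g: "coord_linear k l g" and ns: "\<not> ?sing k f g" for k l f g
    proof -
      obtain \<mu> where \<mu>: "\<And>u. u \<in> coord_space k \<Longrightarrow> f u = coord_scale \<mu> (g u) \<Longrightarrow> u = 0" using ns by blast
      have "coord_linear k l (\<lambda>v. f v - coord_scale \<mu> (g v))"
        unfolding linear_between_def
        by (auto simp: linear_betweenD[OF f] linear_betweenD[OF g] coord.scale_right_distrib
            coord.scale_right_diff_distrib mult.commute simp del: coord_scale_apply)
      then show ?thesis by (rule injective_dim_le) (use \<mu> in simp)
    qed
    have "m \<le> n" by (rule le[OF A B 3(1)])
    moreover have "n \<le> m" by (rule le[OF transposed_linear transposed_linear 3(2)])
    ultimately have mn: "n = m" by simp
    obtain \<mu> where reg: "\<And>u. u \<in> coord_space m \<Longrightarrow> A u = coord_scale \<mu> (B u) \<Longrightarrow> u = 0" using 3(1) by blast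
    show ?thesis
    proof (cases "\<exists>y\<in>coord_space m. B y = 0 \<and> y \<noteq> 0")
      case True
      then have "\<And>x. x \<in> coord_space m \<Longrightarrow> A x = 0 \<Longrightarrow> x = 0"
        using regular_pencil_invertible_arrow[OF X[unfolded mn] reg] by blast
      then obtain p b where "p \<ge> 1" "rep_iso (coord_rep m m A B) (coord_rep p p (\<lambda>v. v) (jordan_map b))"
        by (rule indecomposable_invertible_arrow[OF X[unfolded mn]])
      moreover have "coord_rep p p (\<lambda>v. v) (jordan_map b) \<in> R_reps p (proj_point 1 b)"
        unfolding R_reps_def by blast
      ultimately show ?thesis using proj_point_in_proj_line[of 1 b] mn by auto
    next
      case False
      have "indecomposable (coord_rep m m B A)"
        using indecomposable_swap_arrows[OF X] by (simp add: swap_coord_rep mn)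
      then obtain p b where p: "p \<ge> 1" "rep_iso (coord_rep m m B A) (coord_rep p p (\<lambda>v. v) (jordan_map b))"
        by (rule indecomposable_invertible_arrow) (use False in blast)
      have "rep_iso (coord_rep m m A B) (coord_rep p p (jordan_map b) (\<lambda>v. v))"
        using p(2) swap_arrows_simps(4) by (metis swap_coord_rep)
      moreover have "coord_rep p p (jordan_map b) (\<lambda>v. v) \<in> R_reps p (proj_point b 1)"
        unfolding R_reps_def by blast
      ultimately show ?thesis using p(1) proj_point_in_proj_line[of b 1] mn by auto
    qed
  qed
qed

theorem theorem9p3p1:
  shows
    "(\<forall>r. indecomposable (P_rep r :: ('k::alg_closed_field, nat \<Rightarrow> 'k, nat \<Rightarrow> 'k) kronecker_rep)
        \<and> fin_dim_rep (P_rep r :: ('k, nat \<Rightarrow> 'k, nat \<Rightarrow> 'k) kronecker_rep)) \<and>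
     (\<forall>r. indecomposable (I_rep r :: ('k, nat \<Rightarrow> 'k, nat \<Rightarrow> 'k) kronecker_rep)
        \<and> fin_dim_rep (I_rep r :: ('k, nat \<Rightarrow> 'k, nat \<Rightarrow> 'k) kronecker_rep)) \<and>
     (\<forall>p\<ge>1. \<forall>l\<in>proj_line. \<forall>R \<in> R_reps p (l :: ('k \<times> 'k) set).
        indecomposable R \<and> fin_dim_rep R) \<and>
     (\<forall>X :: ('k, 'a::ab_group_add, 'b::ab_group_add) kronecker_rep.
        fin_dim_rep X \<and> indecomposable X \<longrightarrow>
          (\<exists>r. rep_iso X (P_rep r)) \<or>
          (\<exists>r. rep_iso X (I_rep r)) \<or>
          (\<exists>p\<ge>1. \<exists>l\<in>proj_line. \<exists>R \<in> R_reps p l. rep_iso X R))"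
proof (intro conjI allI impI ballI)
  fix r
  show "indecomposable (P_rep r :: ('k, nat \<Rightarrow> 'k, nat \<Rightarrow> 'k) kronecker_rep)"
    by (rule indecomposable_P_rep)
  show "indecomposable (I_rep r :: ('k, nat \<Rightarrow> 'k, nat \<Rightarrow> 'k) kronecker_rep)"
    by (rule indecomposable_I_rep)
  show "fin_dim_rep (P_rep r :: ('k, nat \<Rightarrow> 'k, nat \<Rightarrow> 'k) kronecker_rep)"
    unfolding P_rep_def by (rule fin_dim_coord_rep)
  show "fin_dim_rep (I_rep r :: ('k, nat \<Rightarrow> 'k, nat \<Rightarrow> 'k) kronecker_rep)"
    unfolding I_rep_def by (rule fin_dim_coord_rep)
next
  fix p :: nat and l :: "('k \<times> 'k) set" and R
  assume "p \<ge> 1" "R \<in> R_reps p l"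
  then show "indecomposable R" "fin_dim_rep R"
    using indecomposable_jordan[of p] fin_dim_coord_rep by (auto simp: R_reps_def)
next
  fix X :: "('k, 'a, 'b) kronecker_rep"
  assume X: "fin_dim_rep X \<and> indecomposable X"
  then have rX: "is_rep X" by (simp add: indecomposable_def)
  then obtain m n A B where Y: "is_rep (coord_rep m n A B)" "rep_iso X (coord_rep m n A B)"
    using fin_dim_rep_coordinates X by blast
  have "indecomposable (coord_rep m n A B)" using indecomposable_iso X Y by blast
  from coord_classification[OF this]
  show "(\<exists>r. rep_iso X (P_rep r)) \<or> (\<exists>r. rep_iso X (I_rep r)) \<or>
      (\<exists>p\<ge>1. \<exists>l\<in>proj_line. \<exists>R \<in> R_reps p l. rep_iso X R)"
    using rep_iso_trans[OF rX Y(2)] by blast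
qed

end
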